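(* Let $(S(t))_{t\ge0}$ be a convex monotone semigroup on $C_\kappa$ with $\Gamma$-generator $A_\Gamma$. Let $f\in C_\kappa$ and let $(f_n)_{n\in\mathbb N}\subset D(A_\Gamma)$ be a sequence with $f_n\to f$ such that $(A_\Gamma f_n)_{n\in\mathbb N}$ is bounded above. Suppose that, for every $\varepsilon>0$ and every compact $K\subset X$, there exist $n_0\in\mathbb N$, $h_0>0$ and a sequence $(r_n)_{n\in\mathbb N}\subset(0,\infty)$ with $r_n\to0$ such that $$\Big(\frac{S(h)f_n-f_n}{h}\Big)(x)\le\sup_{y\in B(x,r_n)}\Big(\frac{S(h)f-f}{h}\Big)(y)+\frac{\varepsilon}{\kappa(x)}$$ for all $h\in(0,h_0]$, $n\ge n_0$ and $x\in K$. Then $f\in D(A_\Gamma)$ and $A_\Gamma f=\Gamma\text{-}\lim_{n\to\infty}A_\Gamma f_n$.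
   Context: $(X,d)$ is a complete separable metric space and $\kappa\colon X\to(0,\infty)$ is bounded and continuous; $B(x,r)=\{y\in X:d(x,y)\le r\}$. Functions are ordered pointwise, $f^+=\max\{f,0\}$, and $\|f\|_\kappa:=\sup_{x\in X}|f(x)|\kappa(x)\in[0,\infty]$. $C_\kappa$ is the space of continuous $f\colon X\to\mathbb R$ with $\|f\|_\kappa<\infty$; $U_\kappa$ is the set of upper semicontinuous $f\colon X\to[-\infty,\infty)$ with $\|f^+\|_\kappa<\infty$. A set $F\subset U_\kappa$ is bounded above if $\sup_{f\in F}\|f^+\|_\kappa<\infty$. Convergence $f_n\to f$ in $C_\kappa$ (mixed topology) means $\sup_n\|f_n\|_\kappa<\infty$ and $\sup_{x\in K}|f_n(x)-f(x)|\to0$ for every compact $K\subset X$. $\Gamma$-limits: for $(f_n)\subset U_\kappa$ bounded above, $(\Gamma\text{-}\limsup_{n\to\infty}f_n)(x):=\sup\{\limsup_n f_n(x_n): x_n\to x\}$; and $f=\Gamma\text{-}\lim_{n\to\infty}f_n$ with $f\in U_\kappa$ means that for every $x\in X$, $f(x)\ge\limsup_nf_n(x_n)$ for every sequence $x_n\to x$, and $f(x)=\lim_nf_n(x_n)$ for some sequence $x_n\to x$. For families, $\Gamma\text{-}\limsup_{s\to t}f_s$ is the pointwise supremum of $\Gamma\text{-}\limsup_n f_{s_n}$ over all sequences $0\le s_n\to t$; and $f=\Gamma\text{-}\lim_{h\downarrow0}f_h$ means $f=\Gamma\text{-}\lim_nf_{h_n}$ for all sequences $h_n>0$, $h_n\to0$.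 A convex monotone semigroup on $C_\kappa$ is a family of operators $S(t)\colon C_\kappa\to C_\kappa$, $t\ge0$, such that: (S1) each $S(t)$ is convex and monotone, and $S(t)f_n\downarrow0$ pointwise whenever $(f_n)\subset C_\kappa$ decreases pointwise to $0$; (S2) $S(0)f=f$ and $S(s+t)f=S(s)S(t)f$; (S3) $\sup_{t\in[0,T]}\|S(t)\frac r\kappa\|_\kappa<\infty$ for all $r,T\ge0$; (S4) $\Gamma\text{-}\limsup_{s\to t}S(s)f\le S(t)f$ for all $t\ge0$, $f\in C_\kappa$. $\mathcal L_S^+$ is the set of $f\in C_\kappa$ with $\limsup_{h\downarrow0}\|\frac{(S(h)f-f)^+}{h}\|_\kappa<\infty$. The $\Gamma$-generator is $A_\Gamma f:=\Gamma\text{-}\lim_{h\downarrow0}\frac{S(h)f-f}{h}\in U_\kappa$, whose domain $D(A_\Gamma)$ consists of all $f\in\mathcal L_S^+$ for which this $\Gamma$-limit exists. *)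

theory Defs
  imports "HOL-Analysis.Analysis"
begin

text \<open>
  Extended-real-valued functions carry the weighted norm; real-valued functions are coerced
  pointwise by \<open>ereal\<close>.
\<close>

definition wnorm :: "('a \<Rightarrow> real) \<Rightarrow> ('a \<Rightarrow> ereal) \<Rightarrow> ereal" where
  "wnorm \<kappa> f = (SUP x. \<bar>f x\<bar> * ereal (\<kappa> x))"

definition pos_part :: "('a \<Rightarrow> ereal) \<Rightarrow> 'a \<Rightarrow> ereal" where
  "pos_part f = (\<lambda>x. max (f x) 0)"

definition C_space :: "('a::metric_space \<Rightarrow> real) \<Rightarrow> ('a \<Rightarrow> real) set" where
  "C_space \<kappa> = {f. continuous_on UNIV f \<and> wnorm \<kappa> (\<lambda>x. ereal (f x)) < \<infinity>}"

definition usc :: "('a::topological_space \<Rightarrow> ereal) \<Rightarrow> bool" where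
  "usc f \<longleftrightarrow> (\<forall>c. open {x. f x < c})"

definition U_space :: "('a::metric_space \<Rightarrow> real) \<Rightarrow> ('a \<Rightarrow> ereal) set" where
  "U_space \<kappa> = {f. usc f \<and> (\<forall>x. f x < \<infinity>) \<and> wnorm \<kappa> (pos_part f) < \<infinity>}"

definition bdd_above_U :: "('a::metric_space \<Rightarrow> real) \<Rightarrow> ('a \<Rightarrow> ereal) set \<Rightarrow> bool" where
  "bdd_above_U \<kappa> F \<longleftrightarrow> F \<subseteq> U_space \<kappa> \<and> (SUP f\<in>F. wnorm \<kappa> (pos_part f)) < \<infinity>"

definition mixed_lim ::
  "('a::metric_space \<Rightarrow> real) \<Rightarrow> (nat \<Rightarrow> 'a \<Rightarrow> real) \<Rightarrow> ('a \<Rightarrow> real) \<Rightarrow> bool" where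
  "mixed_lim \<kappa> f g \<longleftrightarrow>
     (\<forall>n. f n \<in> C_space \<kappa>) \<and> g \<in> C_space \<kappa> \<and>
     (SUP n. wnorm \<kappa> (\<lambda>x. ereal (f n x))) < \<infinity> \<and>
     (\<forall>K. compact K \<longrightarrow> uniform_limit K f g sequentially)"

definition Gamma_limsup :: "(nat \<Rightarrow> 'a::metric_space \<Rightarrow> ereal) \<Rightarrow> 'a \<Rightarrow> ereal" where
  "Gamma_limsup f x = (SUP \<xi>\<in>{\<xi>. \<xi> \<longlonglongrightarrow> x}. limsup (\<lambda>n. f n (\<xi> n)))"

definition Gamma_limsup_at ::
  "(real \<Rightarrow> 'a::metric_space \<Rightarrow> ereal) \<Rightarrow> real \<Rightarrow> 'a \<Rightarrow> ereal" where
  "Gamma_limsup_at f t x =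
     (SUP s\<in>{s. (\<forall>n. 0 \<le> s n) \<and> s \<longlonglongrightarrow> t}. Gamma_limsup (\<lambda>n. f (s n)) x)"

definition Gamma_lim ::
  "('a::metric_space \<Rightarrow> real) \<Rightarrow> (nat \<Rightarrow> 'a \<Rightarrow> ereal) \<Rightarrow> ('a \<Rightarrow> ereal) \<Rightarrow> bool" where
  "Gamma_lim \<kappa> f g \<longleftrightarrow>
     bdd_above_U \<kappa> (range f) \<and> g \<in> U_space \<kappa> \<and>
     (\<forall>x. (\<forall>\<xi>. \<xi> \<longlonglongrightarrow> x \<longrightarrow> limsup (\<lambda>n. f n (\<xi> n)) \<le> g x) \<and>
          (\<exists>\<xi>. \<xi> \<longlonglongrightarrow> x \<and> (\<lambda>n. f n (\<xi> n)) \<longlonglongrightarrow> g x))"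

definition Gamma_lim_at_right_0 ::
  "('a::metric_space \<Rightarrow> real) \<Rightarrow> (real \<Rightarrow> 'a \<Rightarrow> ereal) \<Rightarrow> ('a \<Rightarrow> ereal) \<Rightarrow> bool" where
  "Gamma_lim_at_right_0 \<kappa> f g \<longleftrightarrow>
     (\<forall>h. (\<forall>n. 0 < h n) \<and> h \<longlonglongrightarrow> 0 \<longrightarrow> Gamma_lim \<kappa> (\<lambda>n. f (h n)) g)"

definition decreases_to_0 :: "(nat \<Rightarrow> 'a \<Rightarrow> real) \<Rightarrow> bool" where
  "decreases_to_0 f \<longleftrightarrow> (\<forall>x. decseq (\<lambda>n. f n x) \<and> (\<lambda>n. f n x) \<longlonglongrightarrow> 0)"

text \<open>
  A semigroup is a function on all reals and all functions; only its values for \<open>t \<ge> 0\<close> on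
  \<^const>\<open>C_space\<close> are constrained.
\<close>

locale convex_monotone_semigroup =
  fixes \<kappa> :: "'a::metric_space \<Rightarrow> real"
    and S :: "real \<Rightarrow> ('a \<Rightarrow> real) \<Rightarrow> 'a \<Rightarrow> real"
  assumes maps_to: "\<lbrakk>0 \<le> t; f \<in> C_space \<kappa>\<rbrakk> \<Longrightarrow> S t f \<in> C_space \<kappa>"
    and convex: "\<lbrakk>0 \<le> t; f \<in> C_space \<kappa>; g \<in> C_space \<kappa>; 0 \<le> c; c \<le> 1\<rbrakk> \<Longrightarrow>
        S t (\<lambda>y. c * f y + (1 - c) * g y) x \<le> c * S t f x + (1 - c) * S t g x"
    and monotone: "\<lbrakk>0 \<le> t; f \<in> C_space \<kappa>; g \<in> C_space \<kappa>; \<forall>y. f y \<le> g y\<rbrakk> \<Longrightarrow> S t f x \<le> S t g x"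
    and cont_above: "\<lbrakk>0 \<le> t; \<forall>n. F n \<in> C_space \<kappa>; decreases_to_0 F\<rbrakk> \<Longrightarrow>
        decreases_to_0 (\<lambda>n. S t (F n))"
    and S_0: "f \<in> C_space \<kappa> \<Longrightarrow> S 0 f = f"
    and S_add: "\<lbrakk>0 \<le> s; 0 \<le> t; f \<in> C_space \<kappa>\<rbrakk> \<Longrightarrow> S (s + t) f = S s (S t f)"
    and bounded: "\<lbrakk>0 \<le> r; 0 \<le> T\<rbrakk> \<Longrightarrow>
        (SUP t\<in>{0..T}. wnorm \<kappa> (\<lambda>x. ereal (S t (\<lambda>y. r / \<kappa> y) x))) < \<infinity>"
    and Gamma_usc: "\<lbrakk>0 \<le> t; f \<in> C_space \<kappa>\<rbrakk> \<Longrightarrow>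
        Gamma_limsup_at (\<lambda>s x. ereal (S s f x)) t x \<le> ereal (S t f x)"

definition diff_quot ::
  "(real \<Rightarrow> ('a \<Rightarrow> real) \<Rightarrow> 'a \<Rightarrow> real) \<Rightarrow> ('a \<Rightarrow> real) \<Rightarrow> real \<Rightarrow> 'a \<Rightarrow> ereal" where
  "diff_quot S f h x = ereal ((S h f x - f x) / h)"

definition L_plus ::
  "('a::metric_space \<Rightarrow> real) \<Rightarrow> (real \<Rightarrow> ('a \<Rightarrow> real) \<Rightarrow> 'a \<Rightarrow> real) \<Rightarrow> ('a \<Rightarrow> real) set" where
  "L_plus \<kappa> S =
     {f \<in> C_space \<kappa>. Limsup (at_right 0) (\<lambda>h. wnorm \<kappa> (pos_part (diff_quot S f h))) < \<infinity>}"

definition gen_dom ::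
  "('a::metric_space \<Rightarrow> real) \<Rightarrow> (real \<Rightarrow> ('a \<Rightarrow> real) \<Rightarrow> 'a \<Rightarrow> real) \<Rightarrow> ('a \<Rightarrow> real) set" where
  "gen_dom \<kappa> S = {f \<in> L_plus \<kappa> S. \<exists>g. Gamma_lim_at_right_0 \<kappa> (diff_quot S f) g}"

text \<open>The description is justified by uniqueness of \<open>\<Gamma>\<close>-limits, shown below.\<close>

definition Gamma_gen ::
  "('a::metric_space \<Rightarrow> real) \<Rightarrow> (real \<Rightarrow> ('a \<Rightarrow> real) \<Rightarrow> 'a \<Rightarrow> real) \<Rightarrow> ('a \<Rightarrow> real) \<Rightarrow> 'a \<Rightarrow> ereal"
where
  "Gamma_gen \<kappa> S f = (THE g. Gamma_lim_at_right_0 \<kappa> (diff_quot S f) g)"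

lemma Gamma_lim_le:
  assumes "Gamma_lim \<kappa> f g" "Gamma_lim \<kappa> f g'"
  shows "g x \<le> g' x"
proof -
  obtain \<xi> where \<xi>: "\<xi> \<longlonglongrightarrow> x" "(\<lambda>n. f n (\<xi> n)) \<longlonglongrightarrow> g x"
    using assms(1) unfolding Gamma_lim_def by blast
  have "limsup (\<lambda>n. f n (\<xi> n)) = g x"
    using \<xi>(2) by (simp add: lim_imp_Limsup)
  moreover have "limsup (\<lambda>n. f n (\<xi> n)) \<le> g' x"
    using assms(2) \<xi>(1) unfolding Gamma_lim_def by blast
  ultimately show ?thesis by simp
qed

lemma Gamma_lim_unique:
  assumes "Gamma_lim \<kappa> f g" "Gamma_lim \<kappa> f g'"
  shows "g = g'"
  using Gamma_lim_le[OF assms] Gamma_lim_le[OF assms(2,1)] by (intro ext antisym)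

lemma Gamma_lim_at_right_0_unique:
  assumes "Gamma_lim_at_right_0 \<kappa> f g" "Gamma_lim_at_right_0 \<kappa> f g'"
  shows "g = g'"
proof -
  have "(\<forall>n. 0 < inverse (real (Suc n))) \<and> (\<lambda>n. inverse (real (Suc n))) \<longlonglongrightarrow> 0"
    using LIMSEQ_inverse_real_of_nat by auto
  then have "Gamma_lim \<kappa> (\<lambda>n. f (inverse (real (Suc n)))) g"
    and "Gamma_lim \<kappa> (\<lambda>n. f (inverse (real (Suc n)))) g'"
    using assms[unfolded Gamma_lim_at_right_0_def,
        THEN spec[where x = "\<lambda>n. inverse (real (Suc n))"]] by blast+
  then show ?thesis by (rule Gamma_lim_unique)
qed

lemma Gamma_genI:
  assumes "Gamma_lim_at_right_0 \<kappa> (diff_quot S f) g"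
  shows "Gamma_gen \<kappa> S f = g"
  unfolding Gamma_gen_def using assms Gamma_lim_at_right_0_unique by blast

lemma Gamma_gen_lim:
  assumes "f \<in> gen_dom \<kappa> S"
  shows "Gamma_lim_at_right_0 \<kappa> (diff_quot S f) (Gamma_gen \<kappa> S f)"
  using assms Gamma_genI unfolding gen_dom_def by blast

end

theory Submission
  imports Defs
begin

text \<open>
  Write \<open>A\<close> for the generator, \<open>D\<^sub>h f = (S h f - f) / h\<close>, and let \<open>g\<close> be the upper
  \<open>\<Gamma>\<close>-limit of the functions \<open>A (fn n)\<close>. The theorem is the squeeze of
  \<open>\<Gamma>\<close>-limits
  \<open>\<Gamma>-limsup D\<^sub>h f \<le> \<Gamma>-limsup A (fn n) = g \<le> \<Gamma>-liminf D\<^sub>h f\<close>,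
  whose two halves have quite different origins.

  The right half is where the comparison hypothesis enters (\<open>quotient_large_near\<close>). Near-maximal
  values of \<open>A (fn n)\<close> close to \<open>x\<close> are, for small \<open>h\<close>, nearly values of \<open>D\<^sub>h (fn n)\<close>
  at points close to \<open>x\<close>. All the points involved form a compact set, and the hypothesis for that
  set moves these values to \<open>D\<^sub>h f\<close>.

  The left half (\<open>limsup_quotient_le\<close>) holds for every mixed limit \<open>f\<close>. If a continuous
  \<open>G\<close> dominates \<open>A u\<close>, then convexity bounds the upper right derivative of
  \<open>t \<mapsto> S t u x\<close> by \<open>S t (u + G) x - S t u x\<close>, because \<open>u + h G\<close> is the convex combination
  \<open>(1 - h) u + h (u + G)\<close>. Since \<open>u\<close> lies in the upper Lipschitz set, \<open>t \<mapsto> S t u x\<close> has no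
  upward jumps, and the bound integrates to an estimate for \<open>S h u x - u x\<close> (\<open>S_growth_le\<close>).
  This estimate contains no generator any more, so it passes to the limit \<open>fn n \<rightarrow> f\<close>
  (\<open>S_growth_limit_le\<close>). Upper semicontinuity of the semigroup at time \<open>0\<close> then turns it
  into \<open>D\<^sub>h f \<le> G + small\<close> near \<open>x\<close>, and \<open>G\<close> may decrease to \<open>g\<close>.

  For fixed \<open>t\<close>, every limit passage in \<open>S t\<close> uses only continuity from above along decreasing sequences. What
  makes this sufficient is \<open>Gamma_limsup_envelope\<close>: the upper \<open>\<Gamma>\<close>-limit of a sequence
  that is bounded above is the decreasing limit of continuous functions dominating its tails. It
  applies to \<open>A (fn n)\<close>, to \<open>D\<^sub>h u\<close> for \<open>h \<rightarrow> 0\<close>, and to \<open>\<bar>fn n - f\<bar>\<close>, where it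
  replaces locally uniform convergence by monotone convergence.

  Finally, the left half applied to a subsequence of \<open>fn\<close> shows that all subsequences of
  \<open>A (fn n)\<close> have the same upper \<open>\<Gamma>\<close>-limit \<open>g\<close>, so that \<open>g\<close> is the
  \<open>\<Gamma>\<close>-limit of the whole sequence (\<open>Gamma_lim_gen\<close>).
\<close>

section \<open>Weighted function spaces\<close>

lemma SUP_less_PInf_iff:
  fixes u :: "'i \<Rightarrow> ereal"
  shows "(SUP i\<in>I. u i) < \<infinity> \<longleftrightarrow> (\<exists>C::real. \<forall>i\<in>I. u i \<le> ereal C)"
proof
  assume "(SUP i\<in>I. u i) < \<infinity>"
  then obtain C where "(SUP i\<in>I. u i) < ereal C"
    using ereal_dense2 by blast
  then show "\<exists>C::real. \<forall>i\<in>I. u i \<le> ereal C"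
    by (meson SUP_upper less_imp_le order_trans)
next
  assume "\<exists>C::real. \<forall>i\<in>I. u i \<le> ereal C"
  then obtain C where "\<forall>i\<in>I. u i \<le> ereal C" by blast
  then have "(SUP i\<in>I. u i) \<le> ereal C" by (simp add: SUP_least)
  then show "(SUP i\<in>I. u i) < \<infinity>" by (rule le_less_trans) simp
qed

locale weight =
  fixes \<kappa> :: "'a::metric_space \<Rightarrow> real"
  assumes \<kappa>_pos: "0 < \<kappa> x"
    and \<kappa>_cont: "continuous_on UNIV \<kappa>"
begin

lemma \<kappa>_nz [simp]: "\<kappa> x \<noteq> 0"
  using \<kappa>_pos[of x] by simp

lemma C_space_iff:
  "f \<in> C_space \<kappa> \<longleftrightarrow> continuous_on UNIV f \<and> (\<exists>C. \<forall>x. \<bar>f x\<bar> \<le> C / \<kappa> x)"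
  by (simp add: C_space_def wnorm_def SUP_less_PInf_iff \<kappa>_pos pos_le_divide_eq
      del: ereal_infty_less)

lemma wnorm_pos_part_le_iff:
  assumes "0 \<le> C"
  shows "wnorm \<kappa> (pos_part v) \<le> ereal C \<longleftrightarrow> (\<forall>x. v x \<le> ereal (C / \<kappa> x))"
proof -
  have "\<bar>max (v x) 0\<bar> * ereal (\<kappa> x) \<le> ereal C \<longleftrightarrow> v x \<le> ereal (C / \<kappa> x)" for x
    using \<kappa>_pos[of x] assms
    by (cases "v x") (auto simp: max_def pos_le_divide_eq zero_ereal_def 
         not_le mult_nonpos_nonneg intro: order_trans[of _ 0])
  then show ?thesis by (simp add: wnorm_def pos_part_def SUP_le_iff)
qed

lemma wnorm_pos_part_finite_iff:
  "wnorm \<kappa> (pos_part v) < \<infinity> \<longleftrightarrow> (\<exists>C\<ge>0. \<forall>x. v x \<le> ereal (C / \<kappa> x))"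
proof
  assume "wnorm \<kappa> (pos_part v) < \<infinity>"
  then obtain C where "\<And>x. \<bar>pos_part v x\<bar> * ereal (\<kappa> x) \<le> ereal C"
    unfolding wnorm_def SUP_less_PInf_iff by auto
  then have "wnorm \<kappa> (pos_part v) \<le> ereal (max C 0)"
    unfolding wnorm_def by (intro SUP_least) (meson ereal_less_eq(3) max.cobounded1 order_trans)
  then show "\<exists>C\<ge>0. \<forall>x. v x \<le> ereal (C / \<kappa> x)"
    using wnorm_pos_part_le_iff by (metis max.cobounded2)
next
  assume "\<exists>C\<ge>0. \<forall>x. v x \<le> ereal (C / \<kappa> x)"
  then obtain C where "wnorm \<kappa> (pos_part v) \<le> ereal C"
    using wnorm_pos_part_le_iff by blast
  then show "wnorm \<kappa> (pos_part v) < \<infinity>" by (rule le_less_trans) simp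
qed

lemma bdd_above_U_imp_bound:
  assumes "bdd_above_U \<kappa> (range v)"
  obtains C where "0 \<le> C" "\<And>n x. v n x \<le> ereal (C / \<kappa> x)"
proof -
  have "(SUP n. wnorm \<kappa> (pos_part (v n))) < \<infinity>"
    using assms by (simp add: bdd_above_U_def image_image)
  then obtain C where C: "\<And>n. wnorm \<kappa> (pos_part (v n)) \<le> ereal C"
    unfolding SUP_less_PInf_iff by auto
  then have "\<And>n. wnorm \<kappa> (pos_part (v n)) \<le> ereal (max C 0)"
    by (meson ereal_less_eq(3) max.cobounded1 order_trans)
  then show ?thesis
    using that[of "max C 0"] by (simp add: wnorm_pos_part_le_iff del: ereal_max)
qed

lemma bdd_above_UI:
  assumes "\<And>n. usc (v n)" "\<And>n x. v n x \<le> ereal (C / \<kappa> x)"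
  shows "bdd_above_U \<kappa> (range v)"
proof -
  have *: "v n x \<le> ereal (max C 0 / \<kappa> x)" for n x
    using assms(2)[of n x] \<kappa>_pos[of x]
    by (meson divide_right_mono ereal_less_eq(3) less_imp_le max.cobounded1 order_trans)
  then have le: "wnorm \<kappa> (pos_part (v n)) \<le> ereal (max C 0)" for n
    by (simp add: wnorm_pos_part_le_iff del: ereal_max)
  have "v n x < \<infinity>" for n x
    using *[of n x] by (rule le_less_trans) simp
  moreover have "wnorm \<kappa> (pos_part (v n)) < \<infinity>" for n
    using le[of n] by (rule le_less_trans) (simp del: ereal_max)
  ultimately have "v n \<in> U_space \<kappa>" for n
    using assms(1) unfolding U_space_def by blast
  moreover have "(SUP f\<in>range v. wnorm \<kappa> (pos_part f)) < \<infinity>"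
    unfolding SUP_less_PInf_iff using le by blast
  ultimately show ?thesis unfolding bdd_above_U_def by blast
qed

lemma C_space_const_div: "(\<lambda>y. r / \<kappa> y) \<in> C_space \<kappa>"
  unfolding C_space_iff
  by (auto intro!: continuous_intros \<kappa>_cont exI[of _ "\<bar>r\<bar>"] simp: abs_mult less_imp_le[OF \<kappa>_pos])

lemma C_space_add: "f \<in> C_space \<kappa> \<Longrightarrow> g \<in> C_space \<kappa> \<Longrightarrow> (\<lambda>y. f y + g y) \<in> C_space \<kappa>"
proof -
  assume "f \<in> C_space \<kappa>" "g \<in> C_space \<kappa>"
  then obtain C D where "continuous_on UNIV f" "continuous_on UNIV g"
    and b: "\<And>x. \<bar>f x\<bar> \<le> C / \<kappa> x" "\<And>x. \<bar>g x\<bar> \<le> D / \<kappa> x"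
    by (auto simp: C_space_iff)
  moreover have "\<bar>f x + g x\<bar> \<le> (C + D) / \<kappa> x" for x
    using b[of x] by (simp add: add_divide_distrib)
  ultimately show ?thesis unfolding C_space_iff
    by (intro conjI exI[of _ "C + D"] allI continuous_intros) auto
qed

lemma C_space_scale: "f \<in> C_space \<kappa> \<Longrightarrow> (\<lambda>y. c * f y) \<in> C_space \<kappa>"
proof -
  assume "f \<in> C_space \<kappa>"
  then obtain C where "continuous_on UNIV f" and b: "\<And>x. \<bar>f x\<bar> \<le> C / \<kappa> x"
    by (auto simp: C_space_iff)
  moreover have "\<bar>c * f x\<bar> \<le> (\<bar>c\<bar> * C) / \<kappa> x" for x
    using mult_left_mono[OF b[of x], of "\<bar>c\<bar>"] by (simp add: abs_mult)
  ultimately show ?thesis unfolding C_space_iff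
    by (intro conjI exI[of _ "\<bar>c\<bar> * C"] allI continuous_intros) auto
qed

lemma C_space_uminus: "f \<in> C_space \<kappa> \<Longrightarrow> (\<lambda>y. - f y) \<in> C_space \<kappa>"
  using C_space_scale[of f "-1"] by simp

lemma C_space_diff: "f \<in> C_space \<kappa> \<Longrightarrow> g \<in> C_space \<kappa> \<Longrightarrow> (\<lambda>y. f y - g y) \<in> C_space \<kappa>"
  using C_space_add[OF _ C_space_uminus] by fastforce

lemma C_space_abs: "f \<in> C_space \<kappa> \<Longrightarrow> (\<lambda>y. \<bar>f y\<bar>) \<in> C_space \<kappa>"
  unfolding C_space_iff by (auto intro: continuous_intros)

lemma C_space_max:
  assumes "f \<in> C_space \<kappa>" "g \<in> C_space \<kappa>"
  shows "(\<lambda>y. max (f y) (g y)) \<in> C_space \<kappa>"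
proof -
  have "(\<lambda>y. max (f y) (g y)) = (\<lambda>y. (1/2) * ((f y + g y) + \<bar>f y - g y\<bar>))"
    by (auto simp: max_def abs_if)
  then show ?thesis
    using assms by (simp only:) (intro C_space_scale C_space_add C_space_abs C_space_diff)
qed

lemma C_space_tendsto: "f \<in> C_space \<kappa> \<Longrightarrow> \<xi> \<longlonglongrightarrow> x \<Longrightarrow> (\<lambda>n. f (\<xi> n)) \<longlonglongrightarrow> f x"
  using continuous_on_tendsto_compose[of UNIV f \<xi> x sequentially] by (simp add: C_space_iff)

lemmas C_space_intros = C_space_const_div C_space_add C_space_scale C_space_uminus
  C_space_diff C_space_abs C_space_max

end

section \<open>Upper \<Gamma>-limits as decreasing limits of continuous functions\<close>

lemma Gamma_limsup_leI:
  assumes "\<And>\<xi>. \<xi> \<longlonglongrightarrow> x \<Longrightarrow> limsup (\<lambda>n. v n (\<xi> n)) \<le> c"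
  shows "Gamma_limsup v x \<le> c"
  unfolding Gamma_limsup_def using assms by (auto intro: SUP_least)

lemma limsup_le_Gamma_limsup: "\<xi> \<longlonglongrightarrow> x \<Longrightarrow> limsup (\<lambda>n. v n (\<xi> n)) \<le> Gamma_limsup v x"
  unfolding Gamma_limsup_def by (auto intro: SUP_upper)

text \<open>
  The upper \<open>\<Gamma>\<close>-limit is defined through sequences \<open>\<xi> n \<rightarrow> x\<close> indexed like \<open>v\<close> itself. Large
  values occurring only at some indices are still seen by it: use the corresponding points at those
  indices and \<open>x\<close> at all others.
\<close>

lemma le_Gamma_limsup_if_frequently_near:
  fixes v :: "nat \<Rightarrow> 'a::metric_space \<Rightarrow> ereal"
  assumes "\<And>\<delta> M. 0 < \<delta> \<Longrightarrow> \<exists>n\<ge>M. \<exists>y. dist y x < \<delta> \<and> a \<le> v n y"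
  shows "a \<le> Gamma_limsup v x"
proof -
  define P where "P j n \<longleftrightarrow> (\<exists>y. dist y x < inverse (real (Suc j)) \<and> a \<le> v n y)" for j n
  have ex: "\<exists>n\<ge>M. P j n" for j M
    unfolding P_def by (rule assms) simp
  obtain \<sigma> where \<sigma>: "\<And>j. P j (\<sigma> j)" "\<And>j. \<sigma> j < \<sigma> (Suc j)"
    using dependent_nat_choice[of P "\<lambda>_ m n. m < n"] ex by (metis Suc_le_lessD)
  then have mono: "strict_mono \<sigma>" by (simp add: strict_mono_Suc_iff)
  obtain y where y: "\<And>j. dist (y j) x < inverse (real (Suc j))" "\<And>j. a \<le> v (\<sigma> j) (y j)"
    using \<sigma>(1) unfolding P_def by metis
  define \<xi> where "\<xi> n = (if n \<in> range \<sigma> then y (inv \<sigma> n) else x)" for n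
  have \<xi>\<sigma>: "\<xi> (\<sigma> j) = y j" for j
    using strict_mono_imp_inj_on[OF mono] by (simp add: \<xi>_def)
  have "\<xi> \<longlonglongrightarrow> x"
  proof (rule metric_LIMSEQ_I)
    fix e :: real assume "0 < e"
    then obtain j where j: "inverse (real (Suc j)) < e" using reals_Archimedean by blast
    have "dist (\<xi> n) x < e" if "n \<ge> \<sigma> j" for n
    proof (cases "n \<in> range \<sigma>")
      case True
      then obtain i where i: "n = \<sigma> i" by blast
      then have "i \<ge> j" using that mono by (simp add: strict_mono_less_eq)
      then have "inverse (real (Suc i)) \<le> inverse (real (Suc j))" by (simp add: field_simps)
      then show ?thesis using y(1)[of i] j i \<xi>\<sigma> by (metis le_less_trans less_trans not_less)
    qed (simp add: \<xi>_def \<open>0 < e\<close>)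
    then show "\<exists>M. \<forall>n\<ge>M. dist (\<xi> n) x < e" by blast
  qed
  have "a \<le> limsup ((\<lambda>n. v n (\<xi> n)) \<circ> \<sigma>)"
    by (rule le_Limsup) (auto simp: \<xi>\<sigma> y(2))
  also have "\<dots> \<le> limsup (\<lambda>n. v n (\<xi> n))" by (rule limsup_subseq_mono[OF mono])
  also have "\<dots> \<le> Gamma_limsup v x" by (rule limsup_le_Gamma_limsup) fact
  finally show ?thesis .
qed

text \<open>
  \<open>H N\<close> is, up to the weight, the smallest \<open>N\<close>-Lipschitz function above all \<open>\<kappa> * v n\<close> with
  \<open>n \<ge> N\<close>, that is, a Pasch-Hausdorff envelope. The functions \<open>v n\<close> may take the value \<open>-\<infinity>\<close>;
  truncation at \<open>-N\<close> keeps the envelope finite and disappears in the limit. As \<open>N\<close> grows, only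
  points within distance \<open>O(1/N)\<close> of \<open>x\<close> contribute to \<open>H N x\<close>, since \<open>\<kappa> * v n\<close> is bounded above.
\<close>

lemma (in weight) Gamma_limsup_envelope:
  assumes bd: "\<And>n x. v n x \<le> ereal (C / \<kappa> x)"
  obtains H where "\<And>N. H N \<in> C_space \<kappa>" "\<And>x. decseq (\<lambda>N. H N x)"
    "\<And>N n x. N \<le> n \<Longrightarrow> v n x \<le> ereal (H N x)"
    "\<And>x. Gamma_limsup v x = (INF N. ereal (H N x))"
proof -
  define D where "D = max C 0"
  have vD: "v n y * ereal (\<kappa> y) \<le> ereal D" for n y
    using bd[of n y] \<kappa>_pos[of y] unfolding D_def
    by (cases "v n y") (auto simp: pos_le_divide_eq simp del: ereal_max intro: max.coboundedI1)
  define w where "w N n y = real_of_ereal (max (v n y * ereal (\<kappa> y)) (ereal (- real N)))" for N n y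
  have wE: "ereal (w N n y) = max (v n y * ereal (\<kappa> y)) (ereal (- real N))" for N n y
  proof -
    have "max (v n y * ereal (\<kappa> y)) (ereal (- real N)) \<noteq> \<infinity>"
      using vD[of n y] by (auto simp: max_def)
    moreover have "max (v n y * ereal (\<kappa> y)) (ereal (- real N)) \<noteq> - \<infinity>"
      by (auto simp: max_def)
    ultimately show ?thesis unfolding w_def by (subst ereal_real) auto
  qed
  have w_le: "w N n y \<le> D" for N n y
  proof -
    have "ereal (w N n y) \<le> ereal D" unfolding wE using vD by (auto simp: D_def simp del: ereal_max)
    then show ?thesis by simp
  qed
  have w_ge: "- real N \<le> w N n y" for N n y
  proof -
    have "ereal (- real N) \<le> ereal (w N n y)" unfolding wE by simp
    then show ?thesis by simp
  qed
  have w_mono: "w M n y \<le> w N n y" if "N \<le> M" for M N n y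
  proof -
    have "ereal (w M n y) \<le> ereal (w N n y)" unfolding wE using that
      by (intro max.mono) auto
    then show ?thesis by simp
  qed
  define E where "E N x = (SUP p\<in>{N..}\<times>UNIV. w N (fst p) (snd p) - real N * dist x (snd p))" for N x
  have up: "w N n y - real N * dist x y \<le> D" for N n x y
  proof -
    have "0 \<le> real N * dist x y" by simp
    then show ?thesis using w_le[of N n y] by linarith
  qed
  have E_ge: "w N n y - real N * dist x y \<le> E N x" if "N \<le> n" for N n x y
  proof -
    have "w N (fst (n,y)) (snd (n,y)) - real N * dist x (snd (n,y)) \<le> E N x"
      unfolding E_def using that up by (intro cSUP_upper bdd_aboveI2[of _ _ D]) auto
    then show ?thesis by simp
  qed
  have E_le: "E N x \<le> c" if "\<And>n y. N \<le> n \<Longrightarrow> w N n y - real N * dist x y \<le> c" for N x c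
    unfolding E_def using that by (intro cSUP_least) auto
  have E_lip: "E N x \<le> E N x' + real N * dist x x'" for N x x'
  proof (rule E_le)
    fix n y assume n: "N \<le> n"
    have "real N * dist x' y \<le> real N * (dist x y + dist x x')"
      using dist_triangle[of x' y x] by (intro mult_left_mono) (simp_all add: dist_commute)
    with E_ge[OF n, of y x'] show "w N n y - real N * dist x y \<le> E N x' + real N * dist x x'"
      by (simp add: algebra_simps)
  qed
  have "(real N)-lipschitz_on UNIV (E N)" for N
  proof (rule lipschitz_onI)
    show "dist (E N x) (E N y) \<le> real N * dist x y" for x y
      using E_lip[of N x y] E_lip[of N y x] by (simp add: dist_real_def dist_commute abs_le_iff)
  qed simp
  then have E_cont: "continuous_on UNIV (E N)" for N
    by (rule lipschitz_on_continuous_on)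
  have E_le_D: "E N x \<le> D" for N x by (rule E_le) (rule up)
  have E_ge_N: "- real N \<le> E N x" for N x
    using E_ge[of N N x x] w_ge[of N N x] by simp
  define H where "H N x = E N x / \<kappa> x" for N x
  have H_C: "H N \<in> C_space \<kappa>" for N
  proof -
    have "\<bar>H N x\<bar> \<le> (D + real N) / \<kappa> x" for x
    proof -
      have "\<bar>E N x\<bar> \<le> D + real N"
        using E_le_D[of N x] E_ge_N[of N x] by (auto simp: D_def abs_if)
      then show ?thesis using \<kappa>_pos[of x]
        by (simp add: H_def divide_right_mono)
    qed
    moreover have "continuous_on UNIV (H N)"
      unfolding H_def by (intro continuous_intros E_cont \<kappa>_cont) auto
    ultimately show ?thesis unfolding C_space_iff by blast
  qed
  have H_dec: "decseq (\<lambda>N. H N x)" for x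
  proof (rule decseq_SucI)
    fix N
    have "E (Suc N) x \<le> E N x"
    proof (rule E_le)
      fix n y assume "Suc N \<le> n"
      then have "w N n y - real N * dist x y \<le> E N x" by (intro E_ge) simp
      moreover have "w (Suc N) n y \<le> w N n y" by (rule w_mono) simp
      moreover have "real N * dist x y \<le> real (Suc N) * dist x y"
        by (intro mult_right_mono) auto
      ultimately show "w (Suc N) n y - real (Suc N) * dist x y \<le> E N x" by linarith
    qed
    then show "H (Suc N) x \<le> H N x" using \<kappa>_pos[of x] by (simp add: H_def divide_right_mono)
  qed
  have H_ge: "v n x \<le> ereal (H N x)" if "N \<le> n" for N n x
  proof -
    have "v n x * ereal (\<kappa> x) \<le> ereal (w N n x)" unfolding wE by simp
    also have "\<dots> \<le> ereal (E N x)" using E_ge[OF that, of x x] by simp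
    finally show ?thesis using \<kappa>_pos[of x]
      by (cases "v n x") (auto simp: H_def pos_le_divide_eq)
  qed
  have "Gamma_limsup v x = (INF N. ereal (H N x))" for x
  proof (rule antisym)
    show "Gamma_limsup v x \<le> (INF N. ereal (H N x))"
    proof (intro INF_greatest Gamma_limsup_leI)
      fix N \<xi> assume \<xi>: "\<xi> \<longlonglongrightarrow> x"
      have "limsup (\<lambda>n. v n (\<xi> n)) \<le> limsup (\<lambda>n. ereal (H N (\<xi> n)))"
        by (intro Limsup_mono eventually_sequentiallyI[of N] H_ge)
      also have "\<dots> = ereal (H N x)"
        by (intro lim_imp_Limsup) (auto intro: C_space_tendsto[OF H_C \<xi>])
      finally show "limsup (\<lambda>n. v n (\<xi> n)) \<le> ereal (H N x)" .
    qed
  next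
    show "(INF N. ereal (H N x)) \<le> Gamma_limsup v x"
    proof (rule ccontr)
      assume "\<not> ?thesis"
      then obtain a where a: "Gamma_limsup v x < ereal a" "ereal a < (INF N. ereal (H N x))"
        using ereal_dense2[of "Gamma_limsup v x" "INF N. ereal (H N x)"] unfolding not_le by blast
      obtain b where b: "a < b" "ereal b < (INF N. ereal (H N x))"
        using ereal_dense2[OF a(2)] unfolding ereal_less_eq less_ereal.simps by blast
      have "b < H N x" for N
        using less_INF_D[OF b(2), of N] by simp
      then have Eb: "b * \<kappa> x < E N x" for N
        using \<kappa>_pos[of x] by (simp add: H_def pos_less_divide_eq)
      have "(\<lambda>y. \<kappa> y * a) \<midarrow>x\<rightarrow> \<kappa> x * a"
        using \<kappa>_cont by (intro tendsto_intros) (simp add: continuous_on_def)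
      moreover have "\<kappa> x * a < b * \<kappa> x" using b(1) \<kappa>_pos[of x] by simp
      ultimately have "\<forall>\<^sub>F y in at x. \<kappa> y * a < b * \<kappa> x" by (rule order_tendstoD)
      then obtain \<delta>1 where "0 < \<delta>1"
        and \<delta>1: "\<And>y. y \<noteq> x \<Longrightarrow> dist y x < \<delta>1 \<Longrightarrow> \<kappa> y * a < b * \<kappa> x"
        unfolding eventually_at by auto
      have "ereal a \<le> Gamma_limsup v x"
      proof (rule le_Gamma_limsup_if_frequently_near)
        fix \<delta> :: real and M :: nat assume "0 < \<delta>"
        define \<eta> where "\<eta> = min \<delta> \<delta>1"
        have "0 < \<eta>" using \<open>0 < \<delta>\<close> \<open>0 < \<delta>1\<close> by (simp add: \<eta>_def)
        \<comment> \<open>The three lower bounds make \<open>n \<ge> N\<close> exceed \<open>M\<close>, the truncation inactive, and the penalty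
          strong enough to force the maximising point into the \<open>\<eta>\<close>-ball.\<close>
        obtain N :: nat where N: "max (real M) (max (- (b * \<kappa> x)) ((D - b * \<kappa> x) / \<eta>)) < real N"
          using reals_Archimedean2 by blast
        then obtain n y where n: "N \<le> n" and gt: "b * \<kappa> x < w N n y - real N * dist x y"
          using Eb[of N] E_le[of N x "b * \<kappa> x"] by (meson not_le)
        have "real N * dist x y < D - b * \<kappa> x" using gt w_le[of N n y] by linarith
        also have "\<dots> < real N * \<eta>" using N \<open>0 < \<eta>\<close> by (simp add: pos_divide_less_eq)
        finally have d: "dist y x < \<eta>"
          using N by (simp add: dist_commute)
        have "b * \<kappa> x < w N n y" using gt
          by (rule less_le_trans) simp
        then have "ereal (b * \<kappa> x) < max (v n y * ereal (\<kappa> y)) (ereal (- real N))"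
          unfolding wE[symmetric] by simp
        then have v: "ereal (b * \<kappa> x) < v n y * ereal (\<kappa> y)"
          using N by (auto simp: less_max_iff_disj)
        have "\<kappa> y * a < b * \<kappa> x"
        proof (cases "y = x")
          case True then show ?thesis using \<open>\<kappa> x * a < b * \<kappa> x\<close> by simp
        next
          case False then show ?thesis using \<delta>1 d by (simp add: \<eta>_def)
        qed
        then have "ereal a * ereal (\<kappa> y) < v n y * ereal (\<kappa> y)"
          using less_trans[OF _ v, of "ereal (a * \<kappa> y)"] by (simp add: mult.commute)
        then have "ereal a \<le> v n y"
          using ereal_mult_right_mono[of "v n y" "ereal a" "ereal (\<kappa> y)"] \<kappa>_pos[of y]
          by (meson ereal_less_eq(5) less_imp_le linear not_le)
        moreover have "dist y x < \<delta>" using d by (simp add: \<eta>_def)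
        moreover have "M \<le> n" using n N by simp
        ultimately show "\<exists>n\<ge>M. \<exists>y. dist y x < \<delta> \<and> ereal a \<le> v n y" by blast
      qed
      with a(1) show False by simp
    qed
  qed
  with H_C H_dec H_ge that show ?thesis by blast
qed

section \<open>Compact sets, recovery sequences and one-sided derivatives\<close>

lemma compact_insert_UN_shrinking:
  fixes K :: "nat \<Rightarrow> 'a::metric_space set"
  assumes cpt: "\<And>j. compact (K j)" and sub: "\<And>j. K j \<subseteq> ball x (e j)" and e: "e \<longlonglongrightarrow> 0"
  shows "compact (insert x (\<Union>j. K j))"
proof (rule compactI)
  fix \<C> assume op: "\<forall>t\<in>\<C>. open t" and cover: "insert x (\<Union>j. K j) \<subseteq> \<Union>\<C>"
  then obtain U where U: "U \<in> \<C>" "x \<in> U" by blast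
  then obtain d where d: "0 < d" "ball x d \<subseteq> U"
    using op open_contains_ball by metis
  then obtain J where J: "\<And>j. J \<le> j \<Longrightarrow> e j < d"
    using order_tendstoD(2)[OF e, of d] by (auto simp: eventually_sequentially)
  have "compact (\<Union>j<J. K j)" by (rule compact_UN) (auto intro: cpt)
  moreover have "(\<Union>j<J. K j) \<subseteq> \<Union>\<C>" using cover by blast
  ultimately obtain \<C>' where \<C>': "\<C>' \<subseteq> \<C>" "finite \<C>'" "(\<Union>j<J. K j) \<subseteq> \<Union>\<C>'"
    by (rule compactE) (use op in simp)
  have "K j \<subseteq> \<Union>(insert U \<C>')" for j
  proof (cases "j < J")
    case False
    then have "ball x (e j) \<subseteq> ball x d" using J[of j] by (intro subset_ball) simp
    with sub[of j] have "K j \<subseteq> ball x d" by (rule subset_trans)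
    also note d(2)
    finally show ?thesis by (simp add: le_supI1)
  next
    case True
    then have "K j \<subseteq> (\<Union>j<J. K j)" by blast
    also note \<C>'(3)
    finally show ?thesis by (simp add: le_supI2)
  qed
  then have "insert x (\<Union>j. K j) \<subseteq> \<Union>(insert U \<C>')"
    using U(2) by (simp add: UN_least)
  moreover have "insert U \<C>' \<subseteq> \<C>" "finite (insert U \<C>')" using U(1) \<C>' by simp_all
  ultimately show "\<exists>C'\<subseteq>\<C>. finite C' \<and> insert x (\<Union>j. K j) \<subseteq> \<Union>C'"
    by (intro exI[of _ "insert U \<C>'"] conjI)
qed

lemma compact_insert_sequence:
  fixes \<xi> :: "nat \<Rightarrow> 'a::metric_space"
  assumes "\<xi> \<longlonglongrightarrow> x"
  shows "compact (insert x (range \<xi>))"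
proof -
  define e where "e n = dist (\<xi> n) x + inverse (real (Suc n))" for n
  have "(\<lambda>n. dist (\<xi> n) x) \<longlonglongrightarrow> 0" using assms by (rule tendsto_dist_iff[THEN iffD1])
  from tendsto_add[OF this LIMSEQ_inverse_real_of_nat] have e: "e \<longlonglongrightarrow> 0"
    unfolding e_def by (simp only: add_0_right)
  have "{\<xi> n} \<subseteq> ball x (e n)" for n
    unfolding e_def by (simp add: dist_commute)
  then have "compact (insert x (\<Union>n. {\<xi> n}))"
    using e by (intro compact_insert_UN_shrinking[where e = e]) simp_all
  then show ?thesis by (simp add: UNION_singleton_eq_range)
qed

text \<open>
  \<open>J n\<close> is the largest \<open>j \<le> n\<close> for which \<open>P j n\<close> holds already.
\<close>

lemma eventually_diagonal:
  assumes "\<And>j::nat. \<forall>\<^sub>F n in sequentially. P j n"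
  obtains J where "filterlim J at_top sequentially" "\<forall>\<^sub>F n in sequentially. P (J n) (n::nat)"
proof -
  define J where "J n = (if \<exists>j\<le>n. P j n then Max {j. j \<le> n \<and> P j n} else 0)" for n
  have fin: "finite {j. j \<le> n \<and> P j n}" for n by (rule finite_subset[of _ "{..n}"]) auto
  have J_ge: "j \<le> J n" if "j \<le> n" "P j n" for j n
    using that fin by (auto simp: J_def intro: Max_ge)
  have J_P: "P (J n) n" if "j \<le> n" "P j n" for j n
    using that Max_in[OF fin[of n]] by (auto simp: J_def)
  have ev: "\<forall>\<^sub>F n in sequentially. j \<le> n \<and> P j n" for j
    by (intro eventually_conj assms eventually_ge_at_top)
  show ?thesis
  proof (rule that)
    show "filterlim J at_top sequentially"
      unfolding filterlim_at_top
    proof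
      show "\<forall>\<^sub>F n in sequentially. j \<le> J n" for j
        by (rule eventually_mono[OF ev[of j]]) (simp add: J_ge)
    qed
    show "\<forall>\<^sub>F n in sequentially. P (J n) n"
      by (rule eventually_mono[OF ev[of 0]]) (elim conjE J_P)
  qed
qed

text \<open>
  The existential half of a \<open>\<Gamma>\<close>-limit can be checked level by level: large values near \<open>x\<close> at all late
  indices are combined into one sequence by diagonalisation. At the value \<open>-\<infinity>\<close> there is nothing to
  recover and the constant sequence works.
\<close>

lemma recovery_sequence:
  fixes v :: "nat \<Rightarrow> 'a::metric_space \<Rightarrow> ereal"
  assumes up: "\<And>\<xi>. \<xi> \<longlonglongrightarrow> x \<Longrightarrow> limsup (\<lambda>n. v n (\<xi> n)) \<le> c"
    and near: "\<And>a \<delta>. ereal a < c \<Longrightarrow> 0 < \<delta> \<Longrightarrow> \<forall>\<^sub>F n in sequentially. \<exists>y. dist y x < \<delta> \<and> ereal a < v n y"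
  obtains \<xi> where "\<xi> \<longlonglongrightarrow> x" "(\<lambda>n. v n (\<xi> n)) \<longlonglongrightarrow> c"
proof (cases "c = - \<infinity>")
  case True
  have "(\<lambda>n. v n x) \<longlonglongrightarrow> c"
    using up[of "\<lambda>_. x"] True Liminf_le_Limsup[of sequentially "\<lambda>n. v n x"]
    by (intro Liminf_eq_Limsup) auto
  then show ?thesis using that[of "\<lambda>_. x"] by simp
next
  case False
  then have "- \<infinity> < c" by simp
  then obtain a0 u where a0: "- \<infinity> < a0" "a0 < c" and u: "\<And>j::nat. u j < c" "u \<longlonglongrightarrow> c"
    using approx_from_below_dense_linorder[of "- \<infinity>" c] dense[of "- \<infinity>" c] by blast
  define a where "a j = max (u j) a0" for j
  have a: "- \<infinity> < a j" "a j < c" for j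
    using a0 u(1)[of j] by (simp_all add: a_def less_max_iff_disj)
  have "a \<longlonglongrightarrow> max c a0"
    unfolding a_def by (intro tendsto_max u tendsto_const)
  then have a_lim: "a \<longlonglongrightarrow> c" using a0(2) by (simp add: max_absorb1)
  have areal: "a j = ereal (real_of_ereal (a j))" for j
    using a(1)[of j] a(2)[of j] by (cases "a j") auto
  define Q where "Q j n y \<longleftrightarrow> dist y x < inverse (real (Suc j)) \<and> a j < v n y" for j n y
  have "\<forall>\<^sub>F n in sequentially. \<exists>y. Q j n y" for j
    unfolding Q_def using near[of "real_of_ereal (a j)" "inverse (real (Suc j))"] areal[of j] a(2)[of j]
    by simp
  then obtain J where J: "filterlim J at_top sequentially" "\<forall>\<^sub>F n in sequentially. \<exists>y. Q (J n) n y"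
    by (rule eventually_diagonal)
  define \<xi> where "\<xi> n = (SOME y. Q (J n) n y)" for n
  have Q: "\<forall>\<^sub>F n in sequentially. Q (J n) n (\<xi> n)"
    using J(2) unfolding \<xi>_def by (rule eventually_mono) (rule someI_ex)
  have lim: "\<xi> \<longlonglongrightarrow> x"
  proof (rule tendstoI)
    fix e :: real assume "0 < e"
    have "\<forall>\<^sub>F n in sequentially. inverse (real (Suc (J n))) < e"
      using filterlim_compose[OF LIMSEQ_inverse_real_of_nat J(1)] \<open>0 < e\<close>
      by (rule order_tendstoD)
    with Q show "\<forall>\<^sub>F n in sequentially. dist (\<xi> n) x < e"
      by eventually_elim (auto simp: Q_def)
  qed
  have "c = liminf (\<lambda>n. a (J n))"
    using filterlim_compose[OF a_lim J(1)] by (simp add: lim_imp_Liminf)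
  also have "\<dots> \<le> liminf (\<lambda>n. v n (\<xi> n))"
    using Q by (intro Liminf_mono) (auto simp: Q_def elim: eventually_mono)
  finally have "(\<lambda>n. v n (\<xi> n)) \<longlonglongrightarrow> c"
    using up[OF lim] Liminf_le_Limsup[of sequentially "\<lambda>n. v n (\<xi> n)"]
    by (intro Liminf_eq_Limsup) auto
  with lim show ?thesis by (rule that)
qed

lemma Gamma_limI:
  assumes "bdd_above_U \<kappa> (range v)" "g \<in> U_space \<kappa>"
    and up: "\<And>x \<xi>. \<xi> \<longlonglongrightarrow> x \<Longrightarrow> limsup (\<lambda>n. v n (\<xi> n)) \<le> g x"
    and near: "\<And>x a \<delta>. ereal a < g x \<Longrightarrow> 0 < \<delta> \<Longrightarrow>
      \<forall>\<^sub>F n in sequentially. \<exists>y. dist y x < \<delta> \<and> ereal a < v n y"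
  shows "Gamma_lim \<kappa> v g"
  unfolding Gamma_lim_def
proof (intro conjI allI impI)
  fix x
  obtain \<xi> where "\<xi> \<longlonglongrightarrow> x" "(\<lambda>n. v n (\<xi> n)) \<longlonglongrightarrow> g x"
    by (rule recovery_sequence[OF up near])
  then show "\<exists>\<xi>. \<xi> \<longlonglongrightarrow> x \<and> (\<lambda>n. v n (\<xi> n)) \<longlonglongrightarrow> g x" by blast
qed (fact assms | rule up)+

text \<open>
  A bound on the upper right Dini derivative integrates only if \<open>u\<close> cannot jump upwards from the left.
  The one-sided Lipschitz bound with an arbitrary, possibly huge, constant \<open>L\<close> ensures this, and
  \<open>L\<close> leaves no trace in the conclusion.
\<close>

lemma le_linear_bound_if_local:
  fixes u :: "real \<Rightarrow> real"
  assumes "0 \<le> T"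
    and lip: "0 < e" "\<And>t \<delta>. 0 \<le> t \<Longrightarrow> 0 < \<delta> \<Longrightarrow> \<delta> \<le> e \<Longrightarrow> t + \<delta> \<le> T \<Longrightarrow> u (t + \<delta>) \<le> u t + \<delta> * L"
    and dini: "\<And>t \<eta>. 0 \<le> t \<Longrightarrow> t < T \<Longrightarrow> 0 < \<eta> \<Longrightarrow>
        \<exists>d>0. \<forall>\<delta>\<in>{0<..d}. u (t + \<delta>) \<le> u t + \<delta> * (B + \<eta>)"
  shows "u T \<le> u 0 + T * B"
proof (rule field_le_epsilon)
  fix \<epsilon> :: real assume "0 < \<epsilon>"
  define \<eta> where "\<eta> = \<epsilon> / (T + 1)"
  have "0 < \<eta>" using \<open>0 < \<epsilon>\<close> \<open>0 \<le> T\<close> by (simp add: \<eta>_def)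
  define P where "P t \<longleftrightarrow> u t \<le> u 0 + t * (B + \<eta>)" for t
  define A where "A = {t\<in>{0..T}. \<forall>\<tau>\<in>{0..t}. P \<tau>}"
  have "0 \<in> A" using \<open>0 \<le> T\<close> by (simp add: A_def P_def)
  have bdd: "bdd_above A" unfolding A_def by (auto intro: bdd_aboveI[of _ T])
  define c where "c = Sup A"
  have "0 \<le> c" unfolding c_def by (rule cSup_upper) fact+
  moreover have "c \<le> T" unfolding c_def
    by (rule cSup_least) (use \<open>0 \<in> A\<close> in \<open>auto simp: A_def\<close>)
  ultimately have c: "0 \<le> c" "c \<le> T" by blast+
  have below: "P \<tau>" if \<tau>: "0 \<le> \<tau>" "\<tau> < c" for \<tau>
  proof -
    obtain t where "t \<in> A" "\<tau> < t"
      using \<tau>(2) less_cSup_iff[of A \<tau>] \<open>0 \<in> A\<close> bdd unfolding c_def by blast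
    then show ?thesis using \<tau>(1) by (simp add: A_def)
  qed
  have "P c"
  proof (cases "c = 0")
    case False
    have "u c \<le> u 0 + c * (B + \<eta>)"
    proof (rule tendsto_lowerbound)
      show "((\<lambda>\<delta>. u 0 + (c - \<delta>) * (B + \<eta>) + \<delta> * L) \<longlongrightarrow> u 0 + c * (B + \<eta>)) (at_right 0)"
        by (auto intro!: tendsto_eq_intros)
      have "\<forall>\<^sub>F \<delta> in at_right 0. \<delta> \<in> {0<..<min c e}"
        using c(1) False \<open>0 < e\<close> by (intro eventually_at_right_real) simp
      then show "\<forall>\<^sub>F \<delta> in at_right 0. u c \<le> u 0 + (c - \<delta>) * (B + \<eta>) + \<delta> * L"
      proof eventually_elim
        case (elim \<delta>)
        then show ?case using lip(2)[of "c - \<delta>" \<delta>] below[of "c - \<delta>"] c by (simp add: P_def)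
      qed
    qed simp
    then show ?thesis by (simp add: P_def)
  qed (simp add: P_def)
  have "c = T"
  proof (rule ccontr)
    assume "c \<noteq> T"
    then have "c < T" using c(2) by simp
    then obtain d where d: "0 < d" "\<And>\<delta>. 0 < \<delta> \<Longrightarrow> \<delta> \<le> d \<Longrightarrow> u (c + \<delta>) \<le> u c + \<delta> * (B + \<eta>)"
      using dini[of c \<eta>] c(1) \<open>0 < \<eta>\<close> by auto
    define d' where "d' = min d (T - c)"
    have d': "0 < d'" "d' \<le> d" "c + d' \<le> T" using d(1) \<open>c < T\<close> by (auto simp: d'_def)
    have "P \<tau>" if "0 \<le> \<tau>" "\<tau> \<le> c + d'" for \<tau>
    proof (cases "\<tau> \<le> c")
      case True
      then show ?thesis using below[of \<tau>] \<open>P c\<close> that by (cases "\<tau> = c") auto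
    next
      case False
      then have "u \<tau> \<le> u c + (\<tau> - c) * (B + \<eta>)" using d(2)[of "\<tau> - c"] that d' by simp
      then show ?thesis using \<open>P c\<close> by (simp add: P_def algebra_simps)
    qed
    then have "c + d' \<in> A" using c d' by (simp add: A_def)
    then have "c + d' \<le> c" unfolding c_def using bdd by (rule cSup_upper)
    then show False using d' by simp
  qed
  then have "u T \<le> u 0 + T * B + T * \<eta>" using \<open>P c\<close> by (simp add: P_def algebra_simps)
  also have "T * \<eta> \<le> \<epsilon>" using \<open>0 < \<epsilon>\<close> \<open>0 \<le> T\<close> by (simp add: \<eta>_def field_simps)
  finally show "u T \<le> u 0 + T * B + \<epsilon>" by simp
qed

section \<open>Estimates for the semigroup\<close>

locale weighted_semigroup = weight \<kappa> + convex_monotone_semigroup \<kappa> S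
  for \<kappa> :: "'a::metric_space \<Rightarrow> real" and S
begin

lemma zero_in_C_space: "(\<lambda>_. 0) \<in> C_space \<kappa>"
  using C_space_const_div[of 0] by simp

text \<open>
  Continuity from above for the constant sequence \<open>0\<close> says that the sequence with all terms
  \<open>S t 0\<close> tends to \<open>0\<close>.
\<close>

lemma S_zero: "0 \<le> t \<Longrightarrow> S t (\<lambda>_. 0) x = 0"
proof -
  assume "0 \<le> t"
  have "decreases_to_0 (\<lambda>_::nat. \<lambda>_::'a. 0::real)" by (simp add: decreases_to_0_def decseq_def)
  with \<open>0 \<le> t\<close> have "decreases_to_0 (\<lambda>_::nat. S t (\<lambda>_. 0))"
    by (intro cont_above) (simp_all add: zero_in_C_space)
  then show ?thesis by (simp add: decreases_to_0_def tendsto_const_iff)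
qed

text \<open>
  Convexity at the midpoint \<open>0\<close> of \<open>f\<close> and \<open>-f\<close>. This converts upper bounds for the semigroup into
  lower bounds, for which no semicontinuity is postulated.
\<close>

lemma minus_S_uminus_le: "0 \<le> t \<Longrightarrow> f \<in> C_space \<kappa> \<Longrightarrow> - S t (\<lambda>y. - f y) x \<le> S t f x"
  using convex[of t f "\<lambda>y. - f y" "1/2" x] S_zero[of t x] by (simp add: C_space_uminus)

lemma S_le_weight:
  assumes "0 \<le> r" "0 \<le> T"
  obtains R where "0 \<le> R"
    "\<And>t f x. 0 \<le> t \<Longrightarrow> t \<le> T \<Longrightarrow> f \<in> C_space \<kappa> \<Longrightarrow> (\<And>y. f y \<le> r / \<kappa> y) \<Longrightarrow> S t f x \<le> R / \<kappa> x"
proof -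
  obtain R where "\<forall>t\<in>{0..T}. wnorm \<kappa> (\<lambda>x. ereal (S t (\<lambda>y. r / \<kappa> y) x)) \<le> ereal R"
    using bounded[OF assms] unfolding SUP_less_PInf_iff by blast
  then have R: "\<bar>S t (\<lambda>y. r / \<kappa> y) x\<bar> * \<kappa> x \<le> R" if "0 \<le> t" "t \<le> T" for t x
    using that by (simp add: wnorm_def SUP_le_iff)
  have "S t f x \<le> max R 0 / \<kappa> x"
    if "0 \<le> t" "t \<le> T" "f \<in> C_space \<kappa>" "\<And>y. f y \<le> r / \<kappa> y" for t f x
  proof -
    have "S t f x \<le> S t (\<lambda>y. r / \<kappa> y) x"
      using that by (intro monotone) (auto intro: C_space_const_div)
    also have "\<dots> \<le> \<bar>S t (\<lambda>y. r / \<kappa> y) x\<bar>" by simp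
    also have "\<dots> \<le> max R 0 / \<kappa> x"
      using R[OF that(1,2), of x] \<kappa>_pos[of x] by (simp add: pos_le_divide_eq le_max_iff_disj)
    finally show ?thesis .
  qed
  then show ?thesis using that[of "max R 0"] by simp
qed

text \<open>
  Continuity from above is assumed at \<open>0\<close> only. Convexity transports it to any \<open>f\<close>: split
  \<open>f + a n\<close> as \<open>(1 - u) * (f / (1 - u)) + u * (a n / u)\<close>. For fixed \<open>u\<close> the second part vanishes as
  \<open>n \<rightarrow> \<infinity>\<close>, and the first is close to \<open>S t f x\<close> for small \<open>u\<close>, since the finite convex function
  \<open>c \<mapsto> S t (c * f) x\<close> on the real line is continuous.
\<close>

lemma S_add_decreasing_tendsto:
  assumes t: "0 \<le> t" and f: "f \<in> C_space \<kappa>" and a: "\<And>n. a n \<in> C_space \<kappa>" and dec: "decreases_to_0 a"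
    and "0 < \<eta>"
  shows "\<forall>\<^sub>F n in sequentially. S t (\<lambda>y. f y + a n y) x < S t f x + \<eta>"
proof -
  define \<phi> where "\<phi> c = S t (\<lambda>y. c * f y) x" for c
  have "convex_on UNIV \<phi>"
  proof (rule convex_onI)
    fix u c d :: real assume "0 < u" "u < 1"
    then show "\<phi> ((1 - u) *\<^sub>R c + u *\<^sub>R d) \<le> (1 - u) * \<phi> c + u * \<phi> d"
      using convex[OF t C_space_scale[OF f, of c] C_space_scale[OF f, of d], of "1 - u" x]
      by (simp add: \<phi>_def algebra_simps)
  qed simp
  then have "continuous_on UNIV \<phi>" by (intro convex_on_continuous) simp
  then have \<phi>: "isCont \<phi> c" for c by (simp add: continuous_on_eq_continuous_at)
  have "((\<lambda>u. (1 - u) * \<phi> (1 / (1 - u))) \<longlongrightarrow> (1 - 0) * \<phi> (1 / (1 - 0))) (at_right 0)"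
    by (intro tendsto_intros isCont_tendsto_compose[OF \<phi>]) simp
  then have "\<forall>\<^sub>F u in at_right 0. (1 - u) * \<phi> (1 / (1 - u)) < \<phi> 1 + \<eta> / 2"
    using \<open>0 < \<eta>\<close> by (intro order_tendstoD(2)[of _ "\<phi> 1"]) auto
  moreover have "\<forall>\<^sub>F u in at_right 0. u \<in> {0<..<1::real}"
    by (intro eventually_at_right_real) simp
  ultimately have "\<forall>\<^sub>F u in at_right 0. (1 - u) * \<phi> (1 / (1 - u)) < \<phi> 1 + \<eta> / 2 \<and> u \<in> {0<..<1::real}"
    by (rule eventually_conj)
  then obtain u where u: "0 < u" "u < 1" "(1 - u) * \<phi> (1 / (1 - u)) < \<phi> 1 + \<eta> / 2"
    using eventually_happens'[OF trivial_limit_at_right_real] by force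
  have "decreases_to_0 (\<lambda>n y. (1/u) * a n y)"
    using dec u(1) tendsto_mult_right_zero[of "\<lambda>n. a n y" sequentially "1/u" for y]
    by (auto simp: decreases_to_0_def decseq_def divide_right_mono)
  then have "decreases_to_0 (\<lambda>n. S t (\<lambda>y. (1/u) * a n y))"
    by (intro cont_above t allI C_space_scale a)
  then have "(\<lambda>n. S t (\<lambda>y. (1/u) * a n y) x) \<longlonglongrightarrow> 0" by (simp add: decreases_to_0_def)
  then have "\<forall>\<^sub>F n in sequentially. S t (\<lambda>y. (1/u) * a n y) x < \<eta> / (2 * u)"
    using \<open>0 < \<eta>\<close> u(1) by (intro order_tendstoD(2)) auto
  then show ?thesis
  proof eventually_elim
    case (elim n)
    have "S t (\<lambda>y. f y + a n y) x \<le> (1 - u) * \<phi> (1 / (1 - u)) + u * S t (\<lambda>y. (1/u) * a n y) x"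
      using convex[OF t C_space_scale[OF f, of "1/(1-u)"] C_space_scale[OF a, of "1/u" n], of "1 - u" x] u
      by (simp add: \<phi>_def)
    also have "u * S t (\<lambda>y. (1/u) * a n y) x < \<eta> / 2"
      using elim u(1) by (simp add: field_simps)
    finally show ?case using u(3) by (simp add: \<phi>_def)
  qed
qed

text \<open>
  \<open>f\<close> is the midpoint of \<open>f - a n\<close> and \<open>f + a n\<close>, so by convexity \<open>S t (f - a n)\<close> cannot drop
  noticeably below \<open>S t f\<close> while \<open>S t (f + a n)\<close> tends to \<open>S t f\<close>.
\<close>

lemma S_lower_approx:
  assumes t: "0 \<le> t" and f: "f \<in> C_space \<kappa>" and g: "\<And>n. g n \<in> C_space \<kappa>"
    and a: "\<And>n. a n \<in> C_space \<kappa>" and dec: "decreases_to_0 a"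
    and le: "\<And>n y. f y - a n y \<le> g n y" and "0 < \<eta>"
  shows "\<forall>\<^sub>F n in sequentially. S t f x - \<eta> < S t (g n) x"
  using S_add_decreasing_tendsto[OF t f a dec \<open>0 < \<eta>\<close>, of x]
proof eventually_elim
  case (elim n)
  have "S t f x = S t (\<lambda>y. (1/2) * (f y - a n y) + (1 - 1/2) * (f y + a n y)) x"
    by (simp add: field_simps)
  also have "\<dots> \<le> (1/2) * S t (\<lambda>y. f y - a n y) x + (1 - 1/2) * S t (\<lambda>y. f y + a n y) x"
    by (intro convex t C_space_intros f a) auto
  also have "S t (\<lambda>y. f y - a n y) x \<le> S t (g n) x"
    by (intro monotone t C_space_intros f a g) (simp add: le)
  finally show ?case using elim by simp
qed

text \<open>
  The basic convexity estimate: \<open>S \<delta> f \<le> f + \<delta> * G\<close>, and the right-hand side is the convex combination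
  of \<open>f\<close> and \<open>f + G\<close> with weight \<open>\<delta>\<close>.
\<close>

lemma S_step_le:
  assumes "0 \<le> t" "0 \<le> \<delta>" "\<delta> \<le> 1" and f: "f \<in> C_space \<kappa>" and G: "G \<in> C_space \<kappa>"
    and le: "\<And>y. S \<delta> f y - f y \<le> \<delta> * G y"
  shows "S (t + \<delta>) f x \<le> S t f x + \<delta> * (S t (\<lambda>y. f y + G y) x - S t f x)"
proof -
  have "S (t + \<delta>) f x = S t (S \<delta> f) x" using assms by (simp add: S_add)
  also have "\<dots> \<le> S t (\<lambda>y. \<delta> * (f y + G y) + (1 - \<delta>) * f y) x"
  proof (intro monotone allI)
    show "S \<delta> f y \<le> \<delta> * (f y + G y) + (1 - \<delta>) * f y" for y
      using le[of y] by (simp add: algebra_simps)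
  qed (use assms in \<open>auto intro!: maps_to C_space_intros\<close>)
  also have "\<dots> \<le> \<delta> * S t (\<lambda>y. f y + G y) x + (1 - \<delta>) * S t f x"
    using assms by (intro convex C_space_intros) auto
  finally show ?thesis by (simp add: algebra_simps)
qed

lemma S_usc_at_0:
  assumes f: "f \<in> C_space \<kappa>" and "0 < \<eta>"
  shows "\<exists>\<delta>>0. \<forall>t y. 0 \<le> t \<longrightarrow> t < \<delta> \<longrightarrow> dist y x < \<delta> \<longrightarrow> S t f y < f x + \<eta>"
proof (rule ccontr)
  assume "\<not> ?thesis"
  then have "\<exists>t y. 0 \<le> t \<and> t < \<delta> \<and> dist y x < \<delta> \<and> f x + \<eta> \<le> S t f y" if "0 < \<delta>" for \<delta>
    using that by (meson not_less)
  then have "\<exists>t y. 0 \<le> t \<and> t < inverse (real (Suc n)) \<and> dist y x < inverse (real (Suc n))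
      \<and> f x + \<eta> \<le> S t f y" for n
    by simp
  then obtain t y where ty: "\<And>n. 0 \<le> t n" "\<And>n. t n < inverse (real (Suc n))"
      "\<And>n. dist (y n) x < inverse (real (Suc n))" "\<And>n. f x + \<eta> \<le> S (t n) f (y n)"
    by metis
  have "t \<longlonglongrightarrow> 0"
    by (rule tendsto_sandwich[OF _ _ tendsto_const LIMSEQ_inverse_real_of_nat])
       (use ty in \<open>auto intro!: always_eventually less_imp_le\<close>)
  have "(\<lambda>n. dist (y n) x) \<longlonglongrightarrow> 0"
    by (rule tendsto_sandwich[OF _ _ tendsto_const LIMSEQ_inverse_real_of_nat])
       (use ty in \<open>auto intro!: always_eventually less_imp_le\<close>)
  then have "y \<longlonglongrightarrow> x" by (rule tendsto_dist_iff[THEN iffD2])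
  have "ereal (f x + \<eta>) \<le> limsup (\<lambda>n. ereal (S (t n) f (y n)))"
    by (rule le_Limsup) (simp_all only: trivial_limit_sequentially ereal_less_eq ty(4) always_eventually simp_thms not_False_eq_True)
  also have "\<dots> \<le> Gamma_limsup (\<lambda>n z. ereal (S (t n) f z)) x"
    by (rule limsup_le_Gamma_limsup) fact
  also have "\<dots> \<le> Gamma_limsup_at (\<lambda>s z. ereal (S s f z)) 0 x"
    unfolding Gamma_limsup_at_def using ty(1) \<open>t \<longlonglongrightarrow> 0\<close> by (intro SUP_upper) simp
  also have "\<dots> \<le> ereal (S 0 f x)" by (rule Gamma_usc) (simp_all add: f)
  also have "S 0 f x = f x" by (simp add: S_0 f)
  finally show False using \<open>0 < \<eta>\<close> by simp
qed

end

section \<open>The generator\<close>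

context weighted_semigroup
begin

lemma diff_quot_le_iff: "0 < h \<Longrightarrow> diff_quot S f h x \<le> ereal c \<longleftrightarrow> S h f x - f x \<le> h * c"
  by (simp add: diff_quot_def pos_divide_le_eq mult.commute)

lemma gen_dom_imp_C_space: "f \<in> gen_dom \<kappa> S \<Longrightarrow> f \<in> C_space \<kappa>"
  by (simp add: gen_dom_def L_plus_def)

lemma L_plus_bound:
  assumes "f \<in> L_plus \<kappa> S"
  obtains C e where "0 \<le> C" "0 < e" "\<And>h x. 0 < h \<Longrightarrow> h \<le> e \<Longrightarrow> diff_quot S f h x \<le> ereal (C / \<kappa> x)"
proof -
  have "Limsup (at_right 0) (\<lambda>h. wnorm \<kappa> (pos_part (diff_quot S f h))) < \<infinity>"
    using assms by (simp add: L_plus_def)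
  then obtain c where "Limsup (at_right 0) (\<lambda>h. wnorm \<kappa> (pos_part (diff_quot S f h))) < ereal c"
    using ereal_dense2 by blast
  then have "\<forall>\<^sub>F h in at_right 0. wnorm \<kappa> (pos_part (diff_quot S f h)) < ereal c"
    by (rule Limsup_lessD)
  then obtain d where d: "0 < d" "\<And>h. 0 < h \<Longrightarrow> h < d \<Longrightarrow> wnorm \<kappa> (pos_part (diff_quot S f h)) < ereal c"
    unfolding eventually_at_right_field by auto
  show ?thesis
  proof (rule that[of "max c 0" "d/2"])
    fix h x assume "0 < h" "h \<le> d / 2"
    then have "wnorm \<kappa> (pos_part (diff_quot S f h)) \<le> ereal c"
      using d by (intro less_imp_le) simp
    then have "wnorm \<kappa> (pos_part (diff_quot S f h)) \<le> ereal (max c 0)"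
      by (rule order_trans) simp
    then show "diff_quot S f h x \<le> ereal (max c 0 / \<kappa> x)"
      using wnorm_pos_part_le_iff[of "max c 0"] by simp
  qed (use d in simp_all)
qed

text \<open>
  Taking the supremum over \<open>0 < h \<le> e / (m + 1)\<close> turns the limit \<open>h \<rightarrow> 0\<close> into a limit along a
  sequence and makes a single envelope dominate all quotients with small \<open>h\<close>.
\<close>

lemma Gamma_limsup_SUP_diff_quot_le:
  assumes lim: "Gamma_lim_at_right_0 \<kappa> (diff_quot S f) g" and "0 < e"
  shows "Gamma_limsup (\<lambda>m y. SUP h\<in>{0<..e / real (Suc m)}. diff_quot S f h y) x \<le> g x"
proof (rule Gamma_limsup_leI)
  fix \<xi> assume \<xi>: "\<xi> \<longlonglongrightarrow> x"
  define v where "v m = (SUP h\<in>{0<..e / real (Suc m)}. diff_quot S f h (\<xi> m))" for m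
  have "limsup v \<le> g x"
  proof (rule dense_ge)
    fix a assume a: "g x < a"
    have "\<exists>h. h \<in> {0<..e / real (Suc m)} \<and> (diff_quot S f h (\<xi> m) < a \<longrightarrow> v m \<le> a)" for m
    proof (cases "v m \<le> a")
      case True
      then show ?thesis using \<open>0 < e\<close> by (intro exI[of _ "e / real (Suc m)"]) simp
    next
      case False
      then show ?thesis unfolding v_def not_le less_SUP_iff by (meson less_asym)
    qed
    then obtain h where h: "\<And>m. h m \<in> {0<..e / real (Suc m)}"
      "\<And>m. diff_quot S f (h m) (\<xi> m) < a \<Longrightarrow> v m \<le> a"
      by metis
    have "(\<lambda>m. e * inverse (real (Suc m))) \<longlonglongrightarrow> e * 0"
      by (intro tendsto_mult_left LIMSEQ_inverse_real_of_nat)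
    then have e_lim: "(\<lambda>m. e / real (Suc m)) \<longlonglongrightarrow> 0" by (simp add: divide_inverse)
    have "h \<longlonglongrightarrow> 0"
      by (rule tendsto_sandwich[OF _ _ tendsto_const e_lim])
         (use h(1) in \<open>auto intro!: always_eventually less_imp_le\<close>)
    then have "limsup (\<lambda>m. diff_quot S f (h m) (\<xi> m)) \<le> g x"
      using lim h(1) \<xi> unfolding Gamma_lim_at_right_0_def Gamma_lim_def by simp
    then have "\<forall>\<^sub>F m in sequentially. diff_quot S f (h m) (\<xi> m) < a"
      using a by (intro Limsup_lessD) (rule le_less_trans)
    then have "\<forall>\<^sub>F m in sequentially. v m \<le> a"
      by (rule eventually_mono) (rule h(2))
    then show "limsup v \<le> a" by (rule Limsup_bounded)
  qed
  then show "limsup (\<lambda>m. SUP h\<in>{0<..e / real (Suc m)}. diff_quot S f h (\<xi> m)) \<le> g x"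
    by (simp only: v_def[abs_def])
qed

text \<open>
  The envelopes \<open>H m\<close> of the difference quotients decrease to a limit below \<open>G\<close>, so \<open>a m = max (H m) G - G\<close>
  decreases to \<open>0\<close>. By the step estimate with \<open>G + a m\<close> in place of \<open>G\<close>, the right derivative of
  \<open>t \<mapsto> S t f x\<close> is at most \<open>S t (f + G + a m) x - S t f x\<close>, and this is at most \<open>B + \<eta>\<close> for large
  \<open>m\<close>. The index \<open>m\<close> depends on \<open>t\<close>, so the steps are not uniform in \<open>t\<close>. The crude bound from the
  upper Lipschitz set, which is uniform, excludes upward jumps.
\<close>

lemma S_growth_le:
  assumes f: "f \<in> gen_dom \<kappa> S" and G: "G \<in> C_space \<kappa>"
    and gen: "\<And>y. Gamma_gen \<kappa> S f y \<le> ereal (G y)" and "0 \<le> T"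
    and B: "\<And>t. 0 \<le> t \<Longrightarrow> t \<le> T \<Longrightarrow> S t (\<lambda>y. f y + G y) x - S t f x \<le> B"
  shows "S T f x \<le> f x + T * B"
proof -
  have fC: "f \<in> C_space \<kappa>" and "f \<in> L_plus \<kappa> S"
    using f gen_dom_imp_C_space by (auto simp: gen_dom_def)
  then obtain C e' where C: "0 \<le> C" "0 < e'"
    "\<And>h x. 0 < h \<Longrightarrow> h \<le> e' \<Longrightarrow> diff_quot S f h x \<le> ereal (C / \<kappa> x)"
    by (auto elim: L_plus_bound)
  define e where "e = min e' 1"
  have e: "0 < e" "e \<le> 1" and eC: "\<And>h x. 0 < h \<Longrightarrow> h \<le> e \<Longrightarrow> diff_quot S f h x \<le> ereal (C / \<kappa> x)"
    using C by (auto simp: e_def)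
  define v where "v m y = (SUP h\<in>{0<..e / real (Suc m)}. diff_quot S f h y)" for m y
  have em: "h \<le> e" if "h \<le> e / real (Suc m)" for h m
  proof -
    have "e / real (Suc m) \<le> e" using e by (simp add: field_simps)
    with that show ?thesis by simp
  qed
  have "v m y \<le> ereal (C / \<kappa> y)" for m y
    unfolding v_def by (intro SUP_least eC) (auto intro: em)
  then obtain H where H: "\<And>N. H N \<in> C_space \<kappa>" "\<And>x. decseq (\<lambda>N. H N x)"
    "\<And>N n x. N \<le> n \<Longrightarrow> v n x \<le> ereal (H N x)"
    "\<And>x. Gamma_limsup v x = (INF N. ereal (H N x))"
    using Gamma_limsup_envelope[of v C] by blast
  have "(INF N. ereal (H N y)) \<le> ereal (G y)" for y
    using order_trans[OF Gamma_limsup_SUP_diff_quot_le[OF Gamma_gen_lim[OF f] e(1)] gen[of y]]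
    unfolding H(4)[symmetric] v_def by simp
  then have HG: "(\<lambda>m. ereal (max (H m y) (G y))) \<longlonglongrightarrow> ereal (G y)" for y
  proof -
    have "(\<lambda>m. ereal (H m y)) \<longlonglongrightarrow> (INF N. ereal (H N y))"
      using H(2)[of y] by (intro LIMSEQ_INF) (simp add: decseq_def)
    then have "(\<lambda>m. max (ereal (H m y)) (ereal (G y))) \<longlonglongrightarrow> max (INF N. ereal (H N y)) (ereal (G y))"
      by (intro tendsto_max tendsto_const)
    then show ?thesis using \<open>(INF N. ereal (H N y)) \<le> ereal (G y)\<close> by (simp add: max_absorb2)
  qed
  define a where "a m y = max (H m y) (G y) - G y" for m y
  have aC: "a m \<in> C_space \<kappa>" for m
    unfolding a_def by (intro C_space_intros H(1) G)
  have "(\<lambda>m. a m y) \<longlonglongrightarrow> 0" for y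
    using tendsto_diff[OF HG[of y, unfolded lim_ereal] tendsto_const[of "G y"]] by (simp add: a_def)
  moreover have "decseq (\<lambda>m. a m y)" for y
    unfolding a_def using decseq_SucD[OF H(2)]
    by (intro decseq_SucI diff_right_mono max.mono order_refl)
  ultimately have adec: "decreases_to_0 a" by (simp add: decreases_to_0_def)
  obtain r where r: "0 \<le> r" "\<And>y. f y + C / \<kappa> y \<le> r / \<kappa> y" "\<And>y. - f y \<le> r / \<kappa> y"
  proof -
    obtain D where D: "\<And>y. \<bar>f y\<bar> \<le> D / \<kappa> y" using fC by (auto simp: C_space_iff)
    have "0 \<le> D / \<kappa> x" using D[of x] by (rule order_trans[OF abs_ge_zero])
    then have "0 \<le> D" using \<kappa>_pos[of x] by (simp add: zero_le_divide_iff)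
    show ?thesis
    proof (rule that[of "D + C"])
      show "f y + C / \<kappa> y \<le> (D + C) / \<kappa> y" for y using D[of y] by (simp add: add_divide_distrib)
      show "- f y \<le> (D + C) / \<kappa> y" for y
        using D[of y] divide_nonneg_pos[OF \<open>0 \<le> C\<close> \<kappa>_pos[of y]]
        unfolding add_divide_distrib by linarith
    qed (use \<open>0 \<le> C\<close> \<open>0 \<le> D\<close> in simp)
  qed
  obtain R where R: "0 \<le> R"
    "\<And>t f x. 0 \<le> t \<Longrightarrow> t \<le> T \<Longrightarrow> f \<in> C_space \<kappa> \<Longrightarrow> (\<And>y. f y \<le> r / \<kappa> y) \<Longrightarrow> S t f x \<le> R / \<kappa> x"
    using S_le_weight[OF r(1) \<open>0 \<le> T\<close>] by metis
  have "S T f x \<le> S 0 f x + T * B"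
  proof (rule le_linear_bound_if_local[where u = "\<lambda>t. S t f x", OF \<open>0 \<le> T\<close> e(1)])
    fix t \<delta> assume t: "0 \<le> t" "0 < \<delta>" "\<delta> \<le> e" "t + \<delta> \<le> T"
    have "S \<delta> f y - f y \<le> \<delta> * (C / \<kappa> y)" for y
      using eC[OF t(2,3)] diff_quot_le_iff[OF t(2)] by blast
    then have "S (t + \<delta>) f x \<le> S t f x + \<delta> * (S t (\<lambda>y. f y + C / \<kappa> y) x - S t f x)"
      using t e by (intro S_step_le fC C_space_const_div) linarith+
    also have "S t (\<lambda>y. f y + C / \<kappa> y) x - S t f x \<le> 2 * R / \<kappa> x"
    proof -
      have "S t (\<lambda>y. f y + C / \<kappa> y) x \<le> R / \<kappa> x"
        using t r by (intro R(2) C_space_intros fC) simp_all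
      moreover have "S t (\<lambda>y. - f y) x \<le> R / \<kappa> x"
        using t r by (intro R(2) C_space_intros fC) simp_all
      ultimately show ?thesis using minus_S_uminus_le[OF t(1) fC, of x] by simp
    qed
    finally show "S (t + \<delta>) f x \<le> S t f x + \<delta> * (2 * R / \<kappa> x)" using t(2) by simp
  next
    fix t \<eta> :: real assume t: "0 \<le> t" "t < T" "0 < \<eta>"
    have "\<forall>\<^sub>F m in sequentially. S t (\<lambda>y. (f y + G y) + a m y) x < S t (\<lambda>y. f y + G y) x + \<eta>"
      by (intro S_add_decreasing_tendsto t C_space_intros fC G aC adec)
    then obtain m where m: "S t (\<lambda>y. (f y + G y) + a m y) x < S t (\<lambda>y. f y + G y) x + \<eta>"
      using eventually_happens'[OF sequentially_bot] by blast
    have "S (t + \<delta>) f x \<le> S t f x + \<delta> * (B + \<eta>)" if \<delta>: "0 < \<delta>" "\<delta> \<le> e / real (Suc m)" for \<delta>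
    proof -
      have "diff_quot S f \<delta> y \<le> ereal (G y + a m y)" for y
      proof -
        have "diff_quot S f \<delta> y \<le> v m y" unfolding v_def using \<delta> by (intro SUP_upper) simp
        also have "\<dots> \<le> ereal (H m y)" by (rule H(3)) simp
        also have "\<dots> \<le> ereal (G y + a m y)" by (simp add: a_def)
        finally show ?thesis .
      qed
      then have "S (t + \<delta>) f x \<le> S t f x + \<delta> * (S t (\<lambda>y. f y + (G y + a m y)) x - S t f x)"
        using t \<delta> em[OF \<delta>(2)] e
        by (intro S_step_le fC C_space_intros G aC) (simp_all flip: diff_quot_le_iff)
      also have "S t (\<lambda>y. f y + (G y + a m y)) x - S t f x \<le> B + \<eta>"
        using m B[of t] t by (simp add: add.assoc)
      finally show ?thesis using \<delta>(1) by simp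
    qed
    then show "\<exists>d>0. \<forall>\<delta>\<in>{0<..d}. S (t + \<delta>) f x \<le> S t f x + \<delta> * (B + \<eta>)"
      using e(1) by (intro exI[of _ "e / real (Suc m)"]) simp
  qed
  then show ?thesis by (simp add: S_0 fC)
qed

end

section \<open>Limits of functions in the domain\<close>

locale generator_approximation = weighted_semigroup \<kappa> S
  for \<kappa> :: "'a::metric_space \<Rightarrow> real" and S +
  fixes f :: "'a \<Rightarrow> real" and fn :: "nat \<Rightarrow> 'a \<Rightarrow> real"
  assumes fn_dom: "fn n \<in> gen_dom \<kappa> S"
    and fn_lim: "mixed_lim \<kappa> fn f"
    and gen_bdd: "bdd_above_U \<kappa> (range (\<lambda>n. Gamma_gen \<kappa> S (fn n)))"
begin

abbreviation gen :: "nat \<Rightarrow> 'a \<Rightarrow> ereal" where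
  "gen n \<equiv> Gamma_gen \<kappa> S (fn n)"

lemma f_C: "f \<in> C_space \<kappa>"
  using fn_lim by (simp add: mixed_lim_def)

lemma fn_C: "fn n \<in> C_space \<kappa>"
  using fn_lim by (simp add: mixed_lim_def)

lemma fn_tendsto: "\<xi> \<longlonglongrightarrow> x \<Longrightarrow> (\<lambda>n. fn n (\<xi> n)) \<longlonglongrightarrow> f x"
proof -
  assume \<xi>: "\<xi> \<longlonglongrightarrow> x"
  have "uniform_limit (insert x (range \<xi>)) fn f sequentially"
    using fn_lim compact_insert_sequence[OF \<xi>] by (simp add: mixed_lim_def)
  then have "(\<lambda>n. fn n (\<xi> n) - f (\<xi> n)) \<longlonglongrightarrow> 0"
    by (intro tendstoI) (auto simp: uniform_limit_iff dist_real_def elim!: eventually_mono)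
  from tendsto_add[OF this C_space_tendsto[OF f_C \<xi>]] show ?thesis by simp
qed

text \<open>
  Mixed convergence is dominated by monotone convergence: locally uniform convergence means that
  \<open>\<bar>fn n - f\<bar>\<close> has upper \<open>\<Gamma>\<close>-limit \<open>0\<close>, hence its envelopes decrease to \<open>0\<close>.
\<close>

lemma error_envelope:
  obtains a where "\<And>n. a n \<in> C_space \<kappa>" "decreases_to_0 a"
    "\<And>N n x. N \<le> n \<Longrightarrow> \<bar>fn n x - f x\<bar> \<le> a N x"
proof -
  define v where "v n x = ereal \<bar>fn n x - f x\<bar>" for n x
  have "(SUP n. wnorm \<kappa> (\<lambda>x. ereal (fn n x))) < \<infinity>"
    using fn_lim by (simp add: mixed_lim_def)
  then obtain C where "\<And>n. wnorm \<kappa> (\<lambda>x. ereal (fn n x)) \<le> ereal C"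
    unfolding SUP_less_PInf_iff by auto
  then have C: "\<bar>fn n x\<bar> \<le> C / \<kappa> x" for n x
    using \<kappa>_pos by (simp add: wnorm_def SUP_le_iff pos_le_divide_eq)
  obtain D where D: "\<And>x. \<bar>f x\<bar> \<le> D / \<kappa> x" using f_C by (auto simp: C_space_iff)
  have "v n x \<le> ereal ((C + D) / \<kappa> x)" for n x
    using C[of n x] D[of x] by (simp add: v_def add_divide_distrib)
  then obtain H where H: "\<And>N. H N \<in> C_space \<kappa>" "\<And>x. decseq (\<lambda>N. H N x)"
    "\<And>N n x. N \<le> n \<Longrightarrow> v n x \<le> ereal (H N x)"
    "\<And>x. Gamma_limsup v x = (INF N. ereal (H N x))"
    using Gamma_limsup_envelope[of v "C + D"] by blast
  have ge: "\<bar>fn n x - f x\<bar> \<le> H N x" if "N \<le> n" for N n x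
    using H(3)[OF that, of x] by (simp add: v_def)
  have "Gamma_limsup v x \<le> 0" for x
  proof (rule Gamma_limsup_leI)
    fix \<xi> assume \<xi>: "\<xi> \<longlonglongrightarrow> x"
    have "(\<lambda>n. \<bar>fn n (\<xi> n) - f (\<xi> n)\<bar>) \<longlonglongrightarrow> \<bar>f x - f x\<bar>"
      by (intro tendsto_intros fn_tendsto C_space_tendsto[OF f_C] \<xi>)
    then have "(\<lambda>n. v n (\<xi> n)) \<longlonglongrightarrow> ereal 0" unfolding v_def by simp
    then show "limsup (\<lambda>n. v n (\<xi> n)) \<le> 0" by (simp add: lim_imp_Limsup zero_ereal_def)
  qed
  moreover have "0 \<le> Gamma_limsup v x" for x
    unfolding H(4) using order_trans[OF abs_ge_zero ge] by (intro INF_greatest) auto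
  ultimately have "(INF N. ereal (H N x)) = ereal 0" for x
    unfolding H(4)[symmetric] by (simp add: antisym zero_ereal_def)
  then have "(\<lambda>N. ereal (H N x)) \<longlonglongrightarrow> ereal 0" for x
    using LIMSEQ_INF[of "\<lambda>N. ereal (H N x)"] H(2)[of x] by (simp add: decseq_def)
  then have "decreases_to_0 H" using H(2) by (simp add: decreases_to_0_def)
  with H(1) ge show ?thesis by (intro that)
qed

lemma generator_envelope:
  obtains H where "\<And>N. H N \<in> C_space \<kappa>" "\<And>x. decseq (\<lambda>N. H N x)"
    "\<And>N n x. N \<le> n \<Longrightarrow> gen n x \<le> ereal (H N x)"
    "\<And>x. Gamma_limsup gen x = (INF N. ereal (H N x))"
proof -
  obtain C where "\<And>n x. gen n x \<le> ereal (C / \<kappa> x)"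
    using bdd_above_U_imp_bound[OF gen_bdd] by metis
  then show ?thesis by (rule Gamma_limsup_envelope) (rule that)
qed

text \<open>
  The growth estimate for \<open>fn n\<close>, with every \<open>fn n\<close> on the right-hand side replaced by its bound in terms of
  \<open>f\<close> and the error \<open>a\<close>. The subtracted term \<open>S t (fn n) x\<close> has to be estimated from below, whence
  the summand with \<open>-f + a\<close>. The hypothesis on \<open>B\<close> does not depend on \<open>n\<close>, so \<open>n \<rightarrow> \<infinity>\<close> is
  possible on the left.
\<close>

lemma S_growth_limit_le:
  assumes a: "a \<in> C_space \<kappa>" "\<And>n y. M \<le> n \<Longrightarrow> \<bar>fn n y - f y\<bar> \<le> a y"
    and H: "H \<in> C_space \<kappa>" "\<And>n y. M \<le> n \<Longrightarrow> gen n y \<le> ereal (H y)"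
    and "0 \<le> T"
    and B: "\<And>t. 0 \<le> t \<Longrightarrow> t \<le> T \<Longrightarrow>
        S t (\<lambda>y. f y + a y + H y) x + S t (\<lambda>y. - f y + a y) x \<le> B"
  shows "S T f x \<le> f x + T * B"
proof (rule field_le_epsilon)
  fix \<epsilon> :: real assume "0 < \<epsilon>"
  obtain b where b: "\<And>n. b n \<in> C_space \<kappa>" "decreases_to_0 b"
    "\<And>N n x. N \<le> n \<Longrightarrow> \<bar>fn n x - f x\<bar> \<le> b N x"
    using error_envelope by metis
  have "\<forall>\<^sub>F n in sequentially. S T f x - \<epsilon> / 2 < S T (fn n) x"
  proof (rule S_lower_approx[where a = b])
    show "f y - b n y \<le> fn n y" for n y using b(3)[of n n y] by (simp add: abs_le_iff)
  qed (use b \<open>0 \<le> T\<close> \<open>0 < \<epsilon>\<close> f_C fn_C in auto)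
  moreover have "(\<lambda>n. fn n x) \<longlonglongrightarrow> f x" using fn_tendsto[of "\<lambda>_. x" x] by simp
  then have "\<forall>\<^sub>F n in sequentially. fn n x < f x + \<epsilon> / 2"
    using \<open>0 < \<epsilon>\<close> by (intro order_tendstoD(2)) auto
  moreover have "\<forall>\<^sub>F n in sequentially. M \<le> n" by (rule eventually_ge_at_top)
  ultimately have "\<forall>\<^sub>F n in sequentially. S T f x \<le> f x + T * B + \<epsilon>"
  proof eventually_elim
    case (elim n)
    have "S T (fn n) x \<le> fn n x + T * B"
    proof (rule S_growth_le[OF fn_dom H(1) H(2)[OF elim(3)] \<open>0 \<le> T\<close>])
      fix t assume t: "0 \<le> t" "t \<le> T"
      have ae: "fn n y \<le> f y + a y" "- fn n y \<le> - f y + a y" for y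
        using a(2)[OF elim(3), of y] by (simp_all add: abs_le_iff)
      have "S t (\<lambda>y. fn n y + H y) x \<le> S t (\<lambda>y. f y + a y + H y) x"
        using t ae by (intro monotone C_space_intros fn_C f_C a H) simp_all
      moreover have "S t (\<lambda>y. - fn n y) x \<le> S t (\<lambda>y. - f y + a y) x"
        using t ae by (intro monotone C_space_intros fn_C f_C a) simp_all
      ultimately show "S t (\<lambda>y. fn n y + H y) x - S t (fn n) x \<le> B"
        using B[OF t] minus_S_uminus_le[OF t(1) fn_C, of n x] by linarith
    qed
    with elim show ?case by simp
  qed
  then show "S T f x \<le> f x + T * B + \<epsilon>" by simp
qed

lemma quotient_bounded:
  assumes "0 \<le> T"
  shows "\<exists>C\<ge>0. \<forall>h x. 0 < h \<longrightarrow> h \<le> T \<longrightarrow> diff_quot S f h x \<le> ereal (C / \<kappa> x)"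
proof -
  obtain a where a: "\<And>n. a n \<in> C_space \<kappa>" "decreases_to_0 a"
    "\<And>N n x. N \<le> n \<Longrightarrow> \<bar>fn n x - f x\<bar> \<le> a N x"
    using error_envelope by metis
  obtain H where H: "\<And>N. H N \<in> C_space \<kappa>" "\<And>x. decseq (\<lambda>N. H N x)"
    "\<And>N n x. N \<le> n \<Longrightarrow> gen n x \<le> ereal (H N x)"
    "\<And>x. Gamma_limsup gen x = (INF N. ereal (H N x))"
    using generator_envelope by metis
  let ?u = "\<lambda>y. f y + a 0 y + H 0 y" and ?l = "\<lambda>y. - f y + a 0 y"
  have "?u \<in> C_space \<kappa>" "?l \<in> C_space \<kappa>" by (intro C_space_intros f_C a H)+
  then obtain C D where CD: "\<And>y. \<bar>?u y\<bar> \<le> C / \<kappa> y" "\<And>y. \<bar>?l y\<bar> \<le> D / \<kappa> y"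
    unfolding C_space_iff by metis
  define r where "r = max 0 (max C D)"
  have "C / \<kappa> y \<le> r / \<kappa> y" "D / \<kappa> y \<le> r / \<kappa> y" for y
    using \<kappa>_pos[of y] by (auto simp: r_def intro!: divide_right_mono)
  then have r: "?u y \<le> r / \<kappa> y" "?l y \<le> r / \<kappa> y" for y
    using CD[of y] by (meson abs_le_D1 order_trans)+
  have "0 \<le> r" by (simp add: r_def)
  then obtain R where R: "0 \<le> R"
    "\<And>t f x. 0 \<le> t \<Longrightarrow> t \<le> T \<Longrightarrow> f \<in> C_space \<kappa> \<Longrightarrow> (\<And>y. f y \<le> r / \<kappa> y) \<Longrightarrow> S t f x \<le> R / \<kappa> x"
    using S_le_weight[OF _ \<open>0 \<le> T\<close>] by metis
  show ?thesis
  proof (intro exI[of _ "2 * R"] conjI allI impI)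
    fix h x assume h: "0 < h" "h \<le> T"
    have "S h f x \<le> f x + h * (2 * R / \<kappa> x)"
    proof (rule S_growth_limit_le[where M = 0 and a = "a 0" and H = "H 0"])
      fix t assume "0 \<le> t" "t \<le> h"
      then show "S t ?u x + S t ?l x \<le> 2 * R / \<kappa> x"
        using R(2)[of t ?u x] R(2)[of t ?l x] r \<open>?u \<in> C_space \<kappa>\<close> \<open>?l \<in> C_space \<kappa>\<close> h by simp
    qed (use a(1,3) H(1,3) h in simp_all)
    then show "diff_quot S f h x \<le> ereal (2 * R / \<kappa> x)"
      using diff_quot_le_iff[OF h(1)] by simp
  qed (use R in simp)
qed

text \<open>
  At time \<open>0\<close> the two semigroup terms in the growth estimate add up to \<open>H N x + 2 * a M x\<close>. By upper
  semicontinuity at time \<open>0\<close> they stay close to or below this value for small times and nearby points.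
  Then \<open>M \<rightarrow> \<infinity>\<close> removes the error and \<open>N \<rightarrow> \<infinity>\<close> replaces \<open>H N\<close> by the upper \<open>\<Gamma>\<close>-limit.
\<close>

lemma limsup_quotient_le:
  assumes h: "\<And>n. 0 < h n" "h \<longlonglongrightarrow> 0" and \<xi>: "\<xi> \<longlonglongrightarrow> x"
  shows "limsup (\<lambda>n. diff_quot S f (h n) (\<xi> n)) \<le> Gamma_limsup gen x"
proof -
  obtain a where a: "\<And>n. a n \<in> C_space \<kappa>" "decreases_to_0 a"
    "\<And>N n x. N \<le> n \<Longrightarrow> \<bar>fn n x - f x\<bar> \<le> a N x"
    using error_envelope by metis
  obtain H where H: "\<And>N. H N \<in> C_space \<kappa>" "\<And>x. decseq (\<lambda>N. H N x)"
    "\<And>N n x. N \<le> n \<Longrightarrow> gen n x \<le> ereal (H N x)"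
    "\<And>x. Gamma_limsup gen x = (INF N. ereal (H N x))"
    using generator_envelope by metis
  have "limsup (\<lambda>n. diff_quot S f (h n) (\<xi> n)) \<le> ereal (H N x)" for N
  proof (rule ereal_le_epsilon2)
    fix \<epsilon> :: real assume "0 < \<epsilon>"
    have "(\<lambda>M. a M x) \<longlonglongrightarrow> 0" using a(2) by (simp add: decreases_to_0_def)
    then have "\<forall>\<^sub>F M in sequentially. a M x < \<epsilon> / 4"
      using \<open>0 < \<epsilon>\<close> by (intro order_tendstoD(2)) auto
    then have "\<forall>\<^sub>F M in sequentially. a M x < \<epsilon> / 4 \<and> N \<le> M"
      by (intro eventually_conj eventually_ge_at_top)
    then obtain M where M: "a M x < \<epsilon> / 4" "N \<le> M"
      using eventually_happens'[OF sequentially_bot] by blast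
    let ?u = "\<lambda>y. f y + a M y + H N y" and ?l = "\<lambda>y. - f y + a M y"
    have ul: "?u \<in> C_space \<kappa>" "?l \<in> C_space \<kappa>" by (intro C_space_intros f_C a H)+
    obtain \<delta>1 where \<delta>1: "0 < \<delta>1"
      "\<And>t y. 0 \<le> t \<Longrightarrow> t < \<delta>1 \<Longrightarrow> dist y x < \<delta>1 \<Longrightarrow> S t ?u y < ?u x + \<epsilon> / 4"
      using S_usc_at_0[OF ul(1), of "\<epsilon> / 4" x] \<open>0 < \<epsilon>\<close> by auto
    obtain \<delta>2 where \<delta>2: "0 < \<delta>2"
      "\<And>t y. 0 \<le> t \<Longrightarrow> t < \<delta>2 \<Longrightarrow> dist y x < \<delta>2 \<Longrightarrow> S t ?l y < ?l x + \<epsilon> / 4"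
      using S_usc_at_0[OF ul(2), of "\<epsilon> / 4" x] \<open>0 < \<epsilon>\<close> by auto
    have "\<forall>\<^sub>F n in sequentially. h n < min \<delta>1 \<delta>2"
      using \<delta>1(1) \<delta>2(1) by (intro order_tendstoD(2)[OF h(2)]) simp
    moreover have "\<forall>\<^sub>F n in sequentially. dist (\<xi> n) x < min \<delta>1 \<delta>2"
      using \<delta>1(1) \<delta>2(1) by (intro tendstoD[OF \<xi>]) simp
    ultimately have "\<forall>\<^sub>F n in sequentially. diff_quot S f (h n) (\<xi> n) \<le> ereal (H N x + \<epsilon>)"
    proof eventually_elim
      case (elim n)
      have "S (h n) f (\<xi> n) \<le> f (\<xi> n) + h n * (H N x + \<epsilon>)"
      proof (rule S_growth_limit_le[where M = M and a = "a M" and H = "H N"])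
        fix t assume t: "0 \<le> t" "t \<le> h n"
        have "S t ?u (\<xi> n) < ?u x + \<epsilon> / 4" using t elim by (intro \<delta>1(2)) simp_all
        moreover have "S t ?l (\<xi> n) < ?l x + \<epsilon> / 4" using t elim by (intro \<delta>2(2)) simp_all
        ultimately show "S t ?u (\<xi> n) + S t ?l (\<xi> n) \<le> H N x + \<epsilon>" using M(1) by simp
      qed (use a(1,3) H(1,3) M(2) less_imp_le[OF h(1)] in simp_all)
      then show ?case using diff_quot_le_iff[OF h(1)] by simp
    qed
    then have "limsup (\<lambda>n. diff_quot S f (h n) (\<xi> n)) \<le> ereal (H N x + \<epsilon>)"
      by (rule Limsup_bounded)
    then show "limsup (\<lambda>n. diff_quot S f (h n) (\<xi> n)) \<le> ereal (H N x) + ereal \<epsilon>" by simp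
  qed
  then show ?thesis unfolding H(4) by (rule INF_greatest)
qed

lemma Gamma_limsup_gen_in_U: "Gamma_limsup gen \<in> U_space \<kappa>"
proof -
  obtain H where H: "\<And>N. H N \<in> C_space \<kappa>" "\<And>x. decseq (\<lambda>N. H N x)"
    "\<And>N n x. N \<le> n \<Longrightarrow> gen n x \<le> ereal (H N x)"
    "\<And>x. Gamma_limsup gen x = (INF N. ereal (H N x))"
    using generator_envelope by metis
  have "{x. Gamma_limsup gen x < c} = (\<Union>N. {x. ereal (H N x) < c})" for c
    by (auto simp: H(4) INF_less_iff)
  moreover have "open {x. ereal (H N x) < c}" for N c
  proof -
    have "continuous_on UNIV (\<lambda>x. ereal (H N x))"
      using H(1)[of N] by (intro continuous_on_ereal) (simp add: C_space_iff)
    then show ?thesis by (intro open_Collect_less continuous_on_const)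
  qed
  ultimately have "usc (Gamma_limsup gen)" by (simp add: usc_def open_UN)
  obtain C where C: "0 \<le> C" "\<And>n x. gen n x \<le> ereal (C / \<kappa> x)"
    using bdd_above_U_imp_bound[OF gen_bdd] by metis
  have bd: "Gamma_limsup gen x \<le> ereal (C / \<kappa> x)" for x
  proof (rule Gamma_limsup_leI)
    fix \<xi> assume \<xi>: "\<xi> \<longlonglongrightarrow> x"
    have "limsup (\<lambda>n. gen n (\<xi> n)) \<le> limsup (\<lambda>n. ereal (C / \<kappa> (\<xi> n)))"
      by (intro Limsup_mono always_eventually allI C)
    also have "\<dots> = ereal (C / \<kappa> x)"
      using C_space_tendsto[OF C_space_const_div \<xi>, of C] by (intro lim_imp_Limsup) simp_all
    finally show "limsup (\<lambda>n. gen n (\<xi> n)) \<le> ereal (C / \<kappa> x)" .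
  qed
  have "Gamma_limsup gen x < \<infinity>" for x using bd[of x] by (rule le_less_trans) simp
  moreover have "wnorm \<kappa> (pos_part (Gamma_limsup gen)) < \<infinity>"
    unfolding wnorm_pos_part_finite_iff using bd C(1) by blast
  ultimately show ?thesis using \<open>usc (Gamma_limsup gen)\<close> by (simp add: U_space_def)
qed

lemma subsequence:
  assumes "strict_mono \<sigma>"
  shows "generator_approximation \<kappa> S f (\<lambda>n. fn (\<sigma> n))"
proof
  show "fn (\<sigma> n) \<in> gen_dom \<kappa> S" for n by (rule fn_dom)
  have "uniform_limit K (\<lambda>n. fn (\<sigma> n)) f sequentially" if "compact K" for K
    using fn_lim that filterlim_subseq[OF assms]
    by (auto simp: mixed_lim_def intro: filterlim_compose[of "fn" _ sequentially \<sigma>])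
  moreover have "(SUP n. wnorm \<kappa> (\<lambda>x. ereal (fn (\<sigma> n) x))) < \<infinity>"
    using fn_lim unfolding mixed_lim_def SUP_less_PInf_iff by blast
  ultimately show "mixed_lim \<kappa> (\<lambda>n. fn (\<sigma> n)) f"
    using fn_lim by (simp add: mixed_lim_def)
  show "bdd_above_U \<kappa> (range (\<lambda>n. gen (\<sigma> n)))"
    using gen_bdd unfolding bdd_above_U_def SUP_less_PInf_iff by blast
qed

end

context generator_approximation
begin

lemma frequently_gen_large_near:
  assumes "b < Gamma_limsup gen x" "0 < \<delta>"
  shows "\<exists>n\<ge>j. \<exists>y. dist y x < \<delta> \<and> b < gen n y"
proof -
  obtain \<xi> where \<xi>: "\<xi> \<longlonglongrightarrow> x" "b < limsup (\<lambda>n. gen n (\<xi> n))"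
    using assms(1) by (auto simp: Gamma_limsup_def less_SUP_iff)
  have near: "\<forall>\<^sub>F n in sequentially. dist (\<xi> n) x < \<delta> \<and> j \<le> n"
    by (intro eventually_conj eventually_ge_at_top tendstoD[OF \<xi>(1)] assms(2))
  show ?thesis
  proof (rule ccontr)
    assume no: "\<not> ?thesis"
    have "\<forall>\<^sub>F n in sequentially. gen n (\<xi> n) \<le> b"
      using near
    proof eventually_elim
      case (elim n)
      with no show ?case by (meson not_le)
    qed
    then have "limsup (\<lambda>n. gen n (\<xi> n)) \<le> b" by (rule Limsup_bounded)
    with \<xi>(2) show False by simp
  qed
qed

text \<open>
  The compact set of the comparison hypothesis has to be fixed before its radii \<open>r n\<close> are known. It
  therefore contains, for infinitely many indices \<open>\<nu> j\<close> at once, a point \<open>y j\<close> where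
  \<open>gen (\<nu> j)\<close> is large together with the tail of a recovery sequence \<open>z j\<close> for
  that value along \<open>h\<close>. The tails are chosen within \<open>e j\<close> of \<open>y j\<close>, so the union accumulates, apart from
  the points \<open>y j\<close>, only at \<open>x\<close>.
\<close>

lemma quotient_large_near:
  assumes comparison: "\<forall>\<epsilon>>0. \<forall>K. compact K \<longrightarrow>
          (\<exists>n0::nat. \<exists>h0>0. \<exists>r. (\<forall>n. 0 < r n) \<and> r \<longlonglongrightarrow> 0 \<and>
            (\<forall>h\<in>{0<..h0}. \<forall>n\<ge>n0. \<forall>x\<in>K.
              diff_quot S (fn n) h x
                \<le> (SUP y\<in>cball x (r n). diff_quot S f h y) + ereal (\<epsilon> / \<kappa> x)))"
    and h: "\<And>k. 0 < h k" "h \<longlonglongrightarrow> 0"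
    and a: "ereal a < Gamma_limsup gen x" and "0 < \<delta>"
  shows "\<forall>\<^sub>F k in sequentially. \<exists>y. dist y x < \<delta> \<and> ereal a < diff_quot S f (h k) y"
proof -
  define e where "e j = inverse (real (Suc j))" for j
  have e_pos: "0 < e j" for j by (simp add: e_def)
  have e_lim: "e \<longlonglongrightarrow> 0" unfolding e_def[abs_def] by (rule LIMSEQ_inverse_real_of_nat)
  obtain b where b: "a < b" "ereal b < Gamma_limsup gen x"
    using ereal_dense2[OF a] by auto
  have "\<forall>j. \<exists>n y. j \<le> n \<and> dist y x < e j \<and> ereal b < gen n y"
    using frequently_gen_large_near[OF b(2) e_pos] by blast
  then obtain \<nu> y where y: "\<And>j. j \<le> \<nu> j" "\<And>j. dist (y j) x < e j" "\<And>j. ereal b < gen (\<nu> j) (y j)"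
    by metis
  have "\<exists>z k0. z \<longlonglongrightarrow> y j \<and> (\<forall>k\<ge>k0. ereal b < diff_quot S (fn (\<nu> j)) (h k) (z k) \<and> dist (z k) (y j) < e j)" for j
  proof -
    have "Gamma_lim \<kappa> (\<lambda>k. diff_quot S (fn (\<nu> j)) (h k)) (gen (\<nu> j))"
      using Gamma_gen_lim[OF fn_dom[of "\<nu> j"]] h unfolding Gamma_lim_at_right_0_def by simp
    then obtain z where z: "z \<longlonglongrightarrow> y j" "(\<lambda>k. diff_quot S (fn (\<nu> j)) (h k) (z k)) \<longlonglongrightarrow> gen (\<nu> j) (y j)"
      unfolding Gamma_lim_def by blast
    have "\<forall>\<^sub>F k in sequentially. ereal b < diff_quot S (fn (\<nu> j)) (h k) (z k) \<and> dist (z k) (y j) < e j"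
      by (intro eventually_conj order_tendstoD(1)[OF z(2)] y(3) tendstoD[OF z(1)] e_pos)
    then show ?thesis using z(1) unfolding eventually_sequentially by blast
  qed
  then obtain z k0 where z: "\<And>j. z j \<longlonglongrightarrow> y j"
    "\<And>j k. k0 j \<le> k \<Longrightarrow> ereal b < diff_quot S (fn (\<nu> j)) (h k) (z j k)"
    "\<And>j k. k0 j \<le> k \<Longrightarrow> dist (z j k) (y j) < e j"
    by metis
  have z_near: "dist (z j k) x < 2 * e j" if "k0 j \<le> k" for j k
    using dist_triangle[of "z j k" x "y j"] z(3)[OF that] y(2)[of j] by linarith
  define K where "K j = insert (y j) (range (\<lambda>k. z j (k + k0 j)))" for j
  have cpt: "compact (insert x (\<Union>j. K j))"
  proof (rule compact_insert_UN_shrinking[where e = "\<lambda>j. 2 * e j"])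
    show "compact (K j)" for j
      unfolding K_def by (intro compact_insert_sequence LIMSEQ_ignore_initial_segment z(1))
    have "dist (y j) x < 2 * e j" for j using y(2)[of j] e_pos[of j] by linarith
    then show "K j \<subseteq> ball x (2 * e j)" for j
      unfolding K_def using z_near by (auto simp: dist_commute[of x])
    show "(\<lambda>j. 2 * e j) \<longlonglongrightarrow> 0" using tendsto_mult_left[OF e_lim, of 2] by simp
  qed
  \<comment> \<open>Where \<open>\<kappa> > \<kappa> x / 2\<close>, the error \<open>\<epsilon> / \<kappa>\<close> stays below the gap between the levels \<open>b\<close> and \<open>a\<close>.\<close>
  define \<epsilon> where "\<epsilon> = (b - a) * (\<kappa> x / 2)"
  have "0 < \<epsilon>" using b(1) \<kappa>_pos[of x] by (simp add: \<epsilon>_def)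
  then obtain n0 h0 r where "0 < h0" and r: "r \<longlonglongrightarrow> 0"
    and le: "\<And>h n w. 0 < h \<Longrightarrow> h \<le> h0 \<Longrightarrow> n0 \<le> n \<Longrightarrow> w \<in> insert x (\<Union>j. K j) \<Longrightarrow>
        diff_quot S (fn n) h w \<le> (SUP y\<in>cball w (r n). diff_quot S f h y) + ereal (\<epsilon> / \<kappa> w)"
    using comparison[rule_format, OF \<open>0 < \<epsilon>\<close> cpt] by (metis greaterThanAtMost_iff)
  have "\<forall>\<^sub>F w in nhds x. \<kappa> x / 2 < \<kappa> w"
    using \<kappa>_cont \<kappa>_pos[of x]
    by (intro order_tendstoD(1)[of \<kappa> "\<kappa> x"]) (auto simp: continuous_on_eq_continuous_at isCont_def tendsto_at_iff_tendsto_nhds)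
  then obtain \<delta>' where "0 < \<delta>'" and \<delta>': "\<And>w. dist w x < \<delta>' \<Longrightarrow> \<kappa> x / 2 < \<kappa> w"
    unfolding eventually_nhds_metric by blast
  have "filterlim \<nu> sequentially sequentially"
    using y(1) by (intro filterlim_at_top_mono[OF filterlim_ident]) simp
  from filterlim_compose[OF r this] have "(\<lambda>j. r (\<nu> j)) \<longlonglongrightarrow> 0" .
  then have "\<forall>\<^sub>F j in sequentially. r (\<nu> j) < \<delta> / 2"
    using \<open>0 < \<delta>\<close> by (intro order_tendstoD(2)) auto
  moreover have "\<forall>\<^sub>F j in sequentially. e j < min (\<delta> / 4) (\<delta>' / 2)"
    using \<open>0 < \<delta>\<close> \<open>0 < \<delta>'\<close> by (intro order_tendstoD(2)[OF e_lim]) simp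
  moreover have "\<forall>\<^sub>F j in sequentially. n0 \<le> j" by (rule eventually_ge_at_top)
  ultimately have "\<forall>\<^sub>F j in sequentially. r (\<nu> j) < \<delta> / 2 \<and> e j < min (\<delta> / 4) (\<delta>' / 2) \<and> n0 \<le> j"
    by (intro eventually_conj)
  then obtain j where j: "r (\<nu> j) < \<delta> / 2" "e j < min (\<delta> / 4) (\<delta>' / 2)" "n0 \<le> j"
    using eventually_happens'[OF sequentially_bot] by blast
  have "\<forall>\<^sub>F k in sequentially. h k < h0"
    using \<open>0 < h0\<close> by (intro order_tendstoD(2)[OF h(2)])
  moreover have "\<forall>\<^sub>F k in sequentially. k0 j \<le> k" by (rule eventually_ge_at_top)
  ultimately show ?thesis
  proof eventually_elim
    case (elim k)
    define w where "w = z j k"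
    have "w \<in> K j" using elim(2) unfolding w_def K_def
      by (auto intro: range_eqI[of _ _ "k - k0 j"])
    then have "diff_quot S (fn (\<nu> j)) (h k) w
        \<le> (SUP y\<in>cball w (r (\<nu> j)). diff_quot S f (h k) y) + ereal (\<epsilon> / \<kappa> w)"
      using h(1) elim(1) order_trans[OF j(3) y(1)[of j]] by (intro le) auto
    with z(2)[OF elim(2)]
    have sup: "ereal b < (SUP y\<in>cball w (r (\<nu> j)). diff_quot S f (h k) y) + ereal (\<epsilon> / \<kappa> w)"
      unfolding w_def by (rule less_le_trans)
    have wx: "dist w x < 2 * e j" unfolding w_def by (rule z_near[OF elim(2)])
    then have "\<kappa> x / 2 < \<kappa> w" using j(2) by (intro \<delta>') simp
    then have "\<epsilon> \<le> (b - a) * \<kappa> w"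
      unfolding \<epsilon>_def using b(1) by (intro mult_left_mono) simp_all
    then have "\<epsilon> / \<kappa> w \<le> b - a" using \<kappa>_pos[of w] by (simp add: pos_divide_le_eq)
    have "ereal a < (SUP y\<in>cball w (r (\<nu> j)). diff_quot S f (h k) y)"
    proof (rule ccontr)
      assume "\<not> ?thesis"
      then have "(SUP y\<in>cball w (r (\<nu> j)). diff_quot S f (h k) y) + ereal (\<epsilon> / \<kappa> w) \<le> ereal a + ereal (b - a)"
        using \<open>\<epsilon> / \<kappa> w \<le> b - a\<close> by (intro add_mono) simp_all
      with sup show False by simp
    qed
    then obtain u where u: "dist w u \<le> r (\<nu> j)" "ereal a < diff_quot S f (h k) u"
      by (auto simp: less_SUP_iff)
    have "dist u x < \<delta>"
      using dist_triangle[of u x w] u(1) wx j(1,2) by (simp add: dist_commute)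
    with u(2) show ?case by blast
  qed
qed

lemma Gamma_lim_quotient:
  assumes near: "\<And>h a x \<delta>. (\<And>k. 0 < h k) \<Longrightarrow> h \<longlonglongrightarrow> 0 \<Longrightarrow> ereal a < Gamma_limsup gen x \<Longrightarrow> 0 < \<delta> \<Longrightarrow>
      \<forall>\<^sub>F k in sequentially. \<exists>y. dist y x < \<delta> \<and> ereal a < diff_quot S f (h k) y"
  shows "Gamma_lim_at_right_0 \<kappa> (diff_quot S f) (Gamma_limsup gen)"
  unfolding Gamma_lim_at_right_0_def
proof (intro allI impI)
  fix h :: "nat \<Rightarrow> real" assume h: "(\<forall>n. 0 < h n) \<and> h \<longlonglongrightarrow> 0"
  then have "convergent h" by (elim conjE convergentI)
  then have "Bseq h" by (rule convergent_imp_Bseq)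
  then obtain T where T: "0 < T" "\<And>n. norm (h n) \<le> T" unfolding Bseq_def by auto
  obtain C where "\<forall>h x. 0 < h \<longrightarrow> h \<le> T \<longrightarrow> diff_quot S f h x \<le> ereal (C / \<kappa> x)"
    using quotient_bounded[OF less_imp_le[OF T(1)]] by (elim exE conjE)
  then have C: "diff_quot S f h x \<le> ereal (C / \<kappa> x)" if "0 < h" "h \<le> T" for h x
    using that by simp
  have "usc (diff_quot S f (h n))" for n
  proof -
    have "S (h n) f \<in> C_space \<kappa>" using h by (intro maps_to f_C) (simp add: less_imp_le)
    then have "continuous_on UNIV (diff_quot S f (h n))"
      unfolding diff_quot_def using f_C h
      by (intro continuous_on_ereal continuous_intros) (auto simp: C_space_iff less_imp_neq[symmetric])
    then show ?thesis unfolding usc_def by (intro allI open_Collect_less continuous_on_const)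
  qed
  moreover have "diff_quot S f (h n) x \<le> ereal (C / \<kappa> x)" for n x
    using h abs_le_D1[OF T(2)[of n, unfolded real_norm_def]] by (intro C) simp_all
  ultimately have "bdd_above_U \<kappa> (range (\<lambda>n. diff_quot S f (h n)))"
    by (rule bdd_above_UI)
  then show "Gamma_lim \<kappa> (\<lambda>n. diff_quot S f (h n)) (Gamma_limsup gen)"
  proof (rule Gamma_limI[OF _ Gamma_limsup_gen_in_U])
    show "limsup (\<lambda>n. diff_quot S f (h n) (\<xi> n)) \<le> Gamma_limsup gen x" if "\<xi> \<longlonglongrightarrow> x" for \<xi> x
      using h that by (intro limsup_quotient_le) simp_all
    show "\<forall>\<^sub>F n in sequentially. \<exists>y. dist y x < \<delta> \<and> ereal a < diff_quot S f (h n) y"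
      if "ereal a < Gamma_limsup gen x" "0 < \<delta>" for x a \<delta>
      using h that by (intro near) simp_all
  qed
qed

lemma f_in_L_plus: "f \<in> L_plus \<kappa> S"
proof -
  obtain C where "0 \<le> C" and C: "\<forall>h x. 0 < h \<longrightarrow> h \<le> 1 \<longrightarrow> diff_quot S f h x \<le> ereal (C / \<kappa> x)"
    using quotient_bounded[OF zero_le_one] by (elim exE conjE)
  have "\<forall>\<^sub>F h in at_right 0. h \<in> {0<..<1::real}" by (rule eventually_at_right_real) simp
  then have "\<forall>\<^sub>F h in at_right 0. wnorm \<kappa> (pos_part (diff_quot S f h)) \<le> ereal C"
    by (rule eventually_mono) (simp add: wnorm_pos_part_le_iff C \<open>0 \<le> C\<close>)
  then have "Limsup (at_right 0) (\<lambda>h. wnorm \<kappa> (pos_part (diff_quot S f h))) \<le> ereal C"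
    by (rule Limsup_bounded)
  then have "Limsup (at_right 0) (\<lambda>h. wnorm \<kappa> (pos_part (diff_quot S f h))) < \<infinity>"
    by (rule le_less_trans) simp
  then show ?thesis using f_C by (simp add: L_plus_def)
qed

text \<open>
  If \<open>gen\<close> failed to come close to \<open>g = Gamma_limsup gen\<close> near \<open>x\<close> at infinitely many indices,
  the corresponding subsequence would have upper \<open>\<Gamma>\<close>-limit below \<open>g x\<close> at \<open>x\<close>. That subsequence
  still converges to \<open>f\<close>, so its upper \<open>\<Gamma>\<close>-limit bounds the difference quotients of \<open>f\<close>,
  whose limit is \<open>g\<close>.
\<close>

lemma Gamma_lim_gen:
  assumes lim: "Gamma_lim_at_right_0 \<kappa> (diff_quot S f) (Gamma_limsup gen)"
  shows "Gamma_lim \<kappa> gen (Gamma_limsup gen)"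
proof (rule Gamma_limI[OF gen_bdd Gamma_limsup_gen_in_U])
  show "limsup (\<lambda>n. gen n (\<xi> n)) \<le> Gamma_limsup gen x" if "\<xi> \<longlonglongrightarrow> x" for \<xi> x
    using that by (rule limsup_le_Gamma_limsup)
  show "\<forall>\<^sub>F n in sequentially. \<exists>y. dist y x < \<delta> \<and> ereal a < gen n y"
    if a: "ereal a < Gamma_limsup gen x" and "0 < \<delta>" for x a \<delta>
  proof (rule ccontr)
    assume "\<not> ?thesis"
    from not_eventually_sequentiallyD[OF this] obtain \<sigma> :: "nat \<Rightarrow> nat"
      where \<sigma>_mono: "strict_mono \<sigma>" and "\<forall>n. \<not> (\<exists>y. dist y x < \<delta> \<and> ereal a < gen (\<sigma> n) y)"
      by blast
    then have \<sigma>: "gen (\<sigma> n) y \<le> ereal a" if "dist y x < \<delta>" for n y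
      using that by (meson not_less)
    interpret sub: generator_approximation \<kappa> S f "\<lambda>n. fn (\<sigma> n)"
      by (rule subsequence) fact
    have sub_le: "Gamma_limsup sub.gen x \<le> ereal a"
    proof (rule Gamma_limsup_leI)
      fix \<xi> assume "\<xi> \<longlonglongrightarrow> x"
      from tendstoD[OF this \<open>0 < \<delta>\<close>]
      have "\<forall>\<^sub>F n in sequentially. sub.gen n (\<xi> n) \<le> ereal a"
        by (rule eventually_mono) (rule \<sigma>)
      then show "limsup (\<lambda>n. sub.gen n (\<xi> n)) \<le> ereal a" by (rule Limsup_bounded)
    qed
    define h where "h n = inverse (real (Suc n))" for n
    have h: "\<And>n. 0 < h n" "h \<longlonglongrightarrow> 0"
      unfolding h_def[abs_def] by (simp, rule LIMSEQ_inverse_real_of_nat)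
    then have "Gamma_lim \<kappa> (\<lambda>n. diff_quot S f (h n)) (Gamma_limsup gen)"
      using lim unfolding Gamma_lim_at_right_0_def by blast
    then obtain \<xi> where \<xi>: "\<xi> \<longlonglongrightarrow> x" "(\<lambda>n. diff_quot S f (h n) (\<xi> n)) \<longlonglongrightarrow> Gamma_limsup gen x"
      unfolding Gamma_lim_def by blast
    have "Gamma_limsup gen x = limsup (\<lambda>n. diff_quot S f (h n) (\<xi> n))"
      using lim_imp_Limsup[OF _ \<xi>(2)] by simp
    also have "\<dots> \<le> Gamma_limsup sub.gen x"
      by (rule sub.limsup_quotient_le) fact+
    also note sub_le
    finally show False using a by simp
  qed
qed

end

theorem theorem4p3:
  fixes \<kappa> :: "'a::polish_space \<Rightarrow> real"
    and S :: "real \<Rightarrow> ('a \<Rightarrow> real) \<Rightarrow> 'a \<Rightarrow> real"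
    and f :: "'a \<Rightarrow> real"
    and fn :: "nat \<Rightarrow> 'a \<Rightarrow> real"
  assumes "\<forall>x. 0 < \<kappa> x" and "bounded (range \<kappa>)" and "continuous_on UNIV \<kappa>"
    and "convex_monotone_semigroup \<kappa> S"
    and "f \<in> C_space \<kappa>"
    and "\<forall>n. fn n \<in> gen_dom \<kappa> S"
    and "mixed_lim \<kappa> fn f"
    and "bdd_above_U \<kappa> (range (\<lambda>n. Gamma_gen \<kappa> S (fn n)))"
    and "\<forall>\<epsilon>>0. \<forall>K. compact K \<longrightarrow>
          (\<exists>n0::nat. \<exists>h0>0. \<exists>r. (\<forall>n. 0 < r n) \<and> r \<longlonglongrightarrow> 0 \<and>
            (\<forall>h\<in>{0<..h0}. \<forall>n\<ge>n0. \<forall>x\<in>K.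
              diff_quot S (fn n) h x
                \<le> (SUP y\<in>cball x (r n). diff_quot S f h y) + ereal (\<epsilon> / \<kappa> x)))"
  shows "f \<in> gen_dom \<kappa> S
       \<and> Gamma_lim \<kappa> (\<lambda>n. Gamma_gen \<kappa> S (fn n)) (Gamma_gen \<kappa> S f)"
proof -
  interpret convex_monotone_semigroup \<kappa> S by fact
  interpret generator_approximation \<kappa> S f fn
    using assms by unfold_locales auto
  have lim: "Gamma_lim_at_right_0 \<kappa> (diff_quot S f) (Gamma_limsup gen)"
    by (rule Gamma_lim_quotient) (rule quotient_large_near[OF assms(9)])
  then have "f \<in> gen_dom \<kappa> S" using f_in_L_plus by (auto simp: gen_dom_def)
  moreover have "Gamma_lim \<kappa> gen (Gamma_gen \<kappa> S f)"
    using Gamma_lim_gen[OF lim] Gamma_genI[OF lim] by simp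
  ultimately show ?thesis by blast
qed

end
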